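(* Let $T\ge1$, and let $\bm{\mathcal{F}}=\{\bm{f}=(f_1,\dots,f_T)\}$ be a class of vector-valued functions, $f_t:\mathcal{X}_t\to\mathbb{R}$, satisfying $\max_{1\le t\le T}\sup_{x\in\mathcal{X}_t}|f_t(x)|\le b$ for all $\bm{f}\in\bm{\mathcal{F}}$. Let $X=(X_t^i)_{1\le t\le T,\,1\le i\le N_t}$ be a vector of $\sum_{t=1}^TN_t$ independent random variables, where for each $t$ the variables $X_t^1,\dots,X_t^{N_t}$ are identically distributed in $\mathcal{X}_t$ with law $\mu_t$, and let $\{\sigma_t^i\}_{t,i}$ be a sequence of independent Rademacher variables. If $\frac1T\sup_{\bm{f}\in\bm{\mathcal{F}}}\sum_{t=1}^T\mathrm{Var}(f_t(X_t^1))\le r$, then for every $x>0$, with probability at least $1-e^{-x}$, $$\sup_{\bm{f}\in\bm{\mathcal{F}}}(P\bm{f}-P_N\bm{f})\le\inf_{\alpha>0}\left(2(1+\alpha)\mathcal{R}(\bm{\mathcal{F}})+2\sqrt{\frac{xr}{nT}}+\Big(1+\frac4\alpha\Big)\frac{bx}{nT}\right),$$ where $n=\min_{1\le t\le T}N_t$. Moreover, the same bound also holds for $\sup_{\bm{f}\in\bm{\mathcal{F}}}(P_N\bm{f}-P\bm{f})$.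
   Context: $N=(N_1,\dots,N_T)$, $P\bm{f}:=\frac1T\sum_{t=1}^T\mathbb{E}[f_t(X_t^1)]$, $P_N\bm{f}:=\frac1T\sum_{t=1}^T\frac1{N_t}\sum_{i=1}^{N_t}f_t(X_t^i)$. The multi-task Rademacher complexity is $$\mathcal{R}(\bm{\mathcal{F}}):=\mathbb{E}_{X,\sigma}\left[\sup_{\bm{f}\in\bm{\mathcal{F}}}\frac1T\sum_{t=1}^T\frac1{N_t}\sum_{i=1}^{N_t}\sigma_t^if_t(X_t^i)\right],$$ with the $\sigma_t^i$ independent of $X$. *)

theory Defs
  imports "HOL-Probability.Probability"
begin

text \<open>
  Tasks are numbered \<open>1..T\<close> and task \<open>t\<close> has sample points \<open>1..N t\<close>. The input space
  \<open>\<X>\<^sub>t\<close> is \<open>space (\<mu> t)\<close>, where the measure \<open>\<mu> t\<close> is the law of the samples of task \<open>t\<close>; all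
  input spaces live in one type \<open>'a\<close>, which loses no generality. A vector-valued function is
  \<open>f :: nat \<Rightarrow> 'a \<Rightarrow> real\<close>, relevant only at \<open>f t y\<close> with \<open>1 \<le> t \<le> T\<close> and \<open>y \<in> space (\<mu> t)\<close>.
\<close>

definition sample_index :: "nat \<Rightarrow> (nat \<Rightarrow> nat) \<Rightarrow> (nat \<times> nat) set" where
  "sample_index T N = (SIGMA t:{1..T}. {1..N t})"

definition sample_space ::
    "nat \<Rightarrow> (nat \<Rightarrow> nat) \<Rightarrow> (nat \<Rightarrow> 'a measure) \<Rightarrow> (nat \<times> nat \<Rightarrow> 'a) measure" where
  "sample_space T N \<mu> = PiM (sample_index T N) (\<lambda>(t, i). \<mu> t)"

definition rademacher :: "real measure" where
  "rademacher = uniform_count_measure {-1, 1}"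

definition sign_space ::
    "nat \<Rightarrow> (nat \<Rightarrow> nat) \<Rightarrow> (nat \<times> nat \<Rightarrow> real) measure" where
  "sign_space T N = PiM (sample_index T N) (\<lambda>_. rademacher)"

definition multitask_sample ::
    "'w measure \<Rightarrow> nat \<Rightarrow> (nat \<Rightarrow> nat) \<Rightarrow> (nat \<Rightarrow> 'a measure) \<Rightarrow> (nat \<Rightarrow> nat \<Rightarrow> 'w \<Rightarrow> 'a) \<Rightarrow> bool" where
  "multitask_sample M T N \<mu> X \<longleftrightarrow>
     prob_space.indep_vars M (\<lambda>(t, i). \<mu> t) (\<lambda>(t, i). X t i) (sample_index T N) \<and>
     (\<forall>t\<in>{1..T}. \<forall>i\<in>{1..N t}. distr M (\<mu> t) (X t i) = \<mu> t)"

definition rademacher_signs ::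
    "'w measure \<Rightarrow> nat \<Rightarrow> (nat \<Rightarrow> nat) \<Rightarrow> (nat \<Rightarrow> nat \<Rightarrow> 'w \<Rightarrow> real) \<Rightarrow> bool" where
  "rademacher_signs M T N \<sigma> \<longleftrightarrow>
     prob_space.indep_vars M (\<lambda>_. rademacher) (\<lambda>(t, i). \<sigma> t i) (sample_index T N) \<and>
     (\<forall>t\<in>{1..T}. \<forall>i\<in>{1..N t}. distr M rademacher (\<sigma> t i) = rademacher)"

text \<open>
  The library's \<open>indep_var\<close> needs both variables to have the same value type, hence the formulation
  through the generated sigma-algebras.
\<close>

definition signs_indep_of_sample ::
    "'w measure \<Rightarrow> nat \<Rightarrow> (nat \<Rightarrow> nat) \<Rightarrow> (nat \<Rightarrow> 'a measure) \<Rightarrow>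
     (nat \<Rightarrow> nat \<Rightarrow> 'w \<Rightarrow> 'a) \<Rightarrow> (nat \<Rightarrow> nat \<Rightarrow> 'w \<Rightarrow> real) \<Rightarrow> bool" where
  "signs_indep_of_sample M T N \<mu> X \<sigma> \<longleftrightarrow>
     prob_space.indep_set M
       (sets (vimage_algebra (space M) (\<lambda>\<omega>. \<lambda>(t, i)\<in>sample_index T N. X t i \<omega>) (sample_space T N \<mu>)))
       (sets (vimage_algebra (space M) (\<lambda>\<omega>. \<lambda>(t, i)\<in>sample_index T N. \<sigma> t i \<omega>) (sign_space T N)))"

definition true_mean ::
    "'w measure \<Rightarrow> nat \<Rightarrow> (nat \<Rightarrow> nat \<Rightarrow> 'w \<Rightarrow> 'a) \<Rightarrow> (nat \<Rightarrow> 'a \<Rightarrow> real) \<Rightarrow> real" where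
  "true_mean M T X f = 1 / real T * (\<Sum>t=1..T. prob_space.expectation M (\<lambda>\<omega>. f t (X t 1 \<omega>)))"

definition empirical_mean ::
    "nat \<Rightarrow> (nat \<Rightarrow> nat) \<Rightarrow> (nat \<Rightarrow> 'a \<Rightarrow> real) \<Rightarrow> (nat \<Rightarrow> nat \<Rightarrow> 'a) \<Rightarrow> real" where
  "empirical_mean T N f z = 1 / real T * (\<Sum>t=1..T. 1 / real (N t) * (\<Sum>i=1..N t. f t (z t i)))"

definition rademacher_sup ::
    "nat \<Rightarrow> (nat \<Rightarrow> nat) \<Rightarrow> (nat \<Rightarrow> 'a \<Rightarrow> real) set \<Rightarrow>
     (nat \<Rightarrow> nat \<Rightarrow> 'a) \<Rightarrow> (nat \<Rightarrow> nat \<Rightarrow> real) \<Rightarrow> real" where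
  "rademacher_sup T N F z s =
     (SUP f\<in>F. 1 / real T * (\<Sum>t=1..T. 1 / real (N t) * (\<Sum>i=1..N t. s t i * f t (z t i))))"

definition rademacher_complexity ::
    "'w measure \<Rightarrow> nat \<Rightarrow> (nat \<Rightarrow> nat) \<Rightarrow> (nat \<Rightarrow> nat \<Rightarrow> 'w \<Rightarrow> 'a) \<Rightarrow>
     (nat \<Rightarrow> nat \<Rightarrow> 'w \<Rightarrow> real) \<Rightarrow> (nat \<Rightarrow> 'a \<Rightarrow> real) set \<Rightarrow> real" where
  "rademacher_complexity M T N X \<sigma> F =
     prob_space.expectation M (\<lambda>\<omega>. rademacher_sup T N F (\<lambda>t i. X t i \<omega>) (\<lambda>t i. \<sigma> t i \<omega>))"

text \<open>
  For an uncountable class the suprema need not be measurable; that they are is what gives a meaning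
  to the probability of the deviation event and to the expectation in the Rademacher complexity.
  Measurability is required of the suprema as functions of the sample and the signs. Measurability
  on the underlying probability space alone would not suffice: its sigma-algebra can be strictly
  larger than the one generated by the sample, and then independence of the sample points
  says nothing about the suprema.
\<close>

definition measurable_suprema ::
    "'w measure \<Rightarrow> nat \<Rightarrow> (nat \<Rightarrow> nat) \<Rightarrow> (nat \<Rightarrow> 'a measure) \<Rightarrow>
     (nat \<Rightarrow> nat \<Rightarrow> 'w \<Rightarrow> 'a) \<Rightarrow> (nat \<Rightarrow> 'a \<Rightarrow> real) set \<Rightarrow> bool" where
  "measurable_suprema M T N \<mu> X F \<longleftrightarrow>
     (\<lambda>z. SUP f\<in>F. true_mean M T X f - empirical_mean T N f (curry z))
       \<in> borel_measurable (sample_space T N \<mu>) \<and>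
     (\<lambda>z. SUP f\<in>F. empirical_mean T N f (curry z) - true_mean M T X f)
       \<in> borel_measurable (sample_space T N \<mu>) \<and>
     (\<lambda>(z, s). rademacher_sup T N F (curry z) (curry s))
       \<in> borel_measurable (sample_space T N \<mu> \<Otimes>\<^sub>M sign_space T N)"

end

theory Submission
  imports Defs
begin

text \<open>
  Write \<open>Z\<close> for the supremum of the centered sums and \<open>E\<^sub>i\<close> for integration over the \<open>i\<close>-th sample point
  alone. The coordinatewise soft minimum \<open>z\<^sub>i = - ln (E\<^sub>i (exp (-K Z))) / K\<close> with \<open>K = 4/5\<close> dominates, up
  to a multiple of a variance, what remains of each single sum after removing its \<open>i\<close>-th term. Hence
  \<open>\<Sum>\<^sub>i (Z - z\<^sub>i) \<le> Z + \<beta> V\<close> with \<open>V\<close> the supremum of the summed variances, although the summands are not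
  identically distributed. A modified logarithmic Sobolev inequality in terms of \<open>Z - z\<^sub>i\<close>, valid
  because changing one sample point moves \<open>Z\<close> by at most the common range of the summands,
  tensorizes, and Herbst's argument gives a sub-gamma bound with variance factor \<open>2 (V + 2 E Z)\<close> and
  scale \<open>1/2\<close>. Symmetrization bounds \<open>E Z\<close> by twice the Rademacher complexity, and the
  arithmetic-geometric mean inequality introduces \<open>\<alpha>\<close>.
\<close>

section \<open>Scalar inequalities\<close>

text \<open>Removing the \<open>i\<close>-th term before taking the supremum would give a maximizer
  that depends on \<open>i\<close>: the variances summed over \<open>i\<close> would belong to
  different functions, and the measurability of these further suprema would have to be assumed. The
  soft minimum avoids both. It is an integral transform of \<open>Z\<close> itself, and it is
  bounded below through one and the same \<open>g\<close> in all coordinates. The price is that the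
  numerical constants must fit together. The quadratic bound on \<open>exp\<close> has coefficient
  \<open>27/40\<close>, hence \<open>\<beta> = 27/50\<close>; the entropy factor leads to
  \<open>(1 + t/3)^5 = 1 + t * p\<close>; and \<open>100/27\<close> bounds
  \<open>p * (2 - t)\<close>, so that \<open>100/27 * 27/50 = 2\<close> is the constant in front of
  \<open>V\<close>, while \<open>100/27 \<le> 4\<close> covers the one in front of
  \<open>E Z\<close>. The oscillation of a summand is followed instead of its sup norm: centering
  leaves it at \<open>2 b\<close> times the weight, whereas a norm bound on the centered summand
  would only give twice that oscillation.\<close>

lemma exp_four_fifths_le: "exp (4/5 :: real) \<le> 279/125"
proof -
  \<comment> \<open>The fifth power reduces the bound to the known one on \<open>exp 1\<close>. It
    serves twice: in a Taylor remainder, and inverted as a lower bound on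
    \<open>exp (-(4/5))\<close>.\<close>
  have "exp (4/5 :: real) ^ 5 = exp 1 ^ 4"
    by (simp flip: exp_of_nat_mult)
  also have "\<dots> \<le> (272/100) ^ 4"
    using e_less_272 by (intro power_mono) auto
  also have "\<dots> \<le> (279/125 :: real) ^ 5"
    by (simp add: eval_nat_numeral)
  finally show ?thesis
    by (rule power_le_imp_le_base[where n = 4, simplified]) auto
qed

text \<open>Taylor's formula, with all terms beyond the first order absorbed into \<open>u^2\<close>
  by means of \<open>|u| \<le> 4/5\<close>. The coefficient comes out as about \<open>0.6695\<close>
  and is rounded up to \<open>27/40\<close>.\<close>

lemma exp_le_quadratic:
  fixes u :: real
  assumes "\<bar>u\<bar> \<le> 4/5"
  shows "exp u \<le> 1 + u + 27/40 * u\<^sup>2"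
proof -
  obtain t where t: "\<bar>t\<bar> \<le> \<bar>u\<bar>" "exp u = (\<Sum>m<5. u ^ m / fact m) + exp t / fact 5 * u ^ 5"
    using Maclaurin_exp_le[of u 5] by blast
  have "exp t \<le> exp (4/5)" using t(1) assms by simp
  hence et: "exp t \<le> 279/125" using exp_four_fifths_le by linarith
  have u2: "u^2 \<le> 16/25" using abs_le_square_iff[of u "4/5"] assms by (simp add: power2_eq_square)
  have "exp t / fact 5 * u ^ 5 = u^2 * (exp t / 120 * u * u^2)"
    by (simp add: fact_numeral power2_eq_square algebra_simps eval_nat_numeral)
  also have "\<dots> \<le> u^2 * (279/125/120 * (4/5) * (16/25))"
  proof (rule mult_left_mono)
    have "exp t / 120 * u * u^2 \<le> exp t / 120 * \<bar>u\<bar> * u^2"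
      by (intro mult_right_mono mult_left_mono) auto
    also have "\<dots> \<le> 279/125/120 * (4/5) * (16/25)"
      using et assms u2 by (intro mult_mono) auto
    finally show "exp t / 120 * u * u^2 \<le> 279/125/120 * (4/5) * (16/25)" .
  qed auto
  finally have 1: "exp t / fact 5 * u ^ 5 \<le> u^2 * (279/125/120 * (4/5) * (16/25))" .
  have "u^3 / 6 = u^2 * (u/6)" by (simp add: power2_eq_square power3_eq_cube)
  also have "\<dots> \<le> u^2 * (4/30)" using assms by (intro mult_left_mono) auto
  finally have 2: "u^3/6 \<le> u^2 * (4/30)" .
  have "u^4 / 24 = u^2 * (u^2/24)" by (simp add: power2_eq_square eval_nat_numeral)
  also have "\<dots> \<le> u^2 * (16/25/24)" using u2 by (intro mult_left_mono) auto
  finally have 3: "u^4/24 \<le> u^2 * (16/25/24)" .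
  have "(\<Sum>m<5. u ^ m / fact m) = 1 + u + u^2/2 + u^3/6 + u^4/24"
    by (simp add: eval_nat_numeral algebra_simps)
  hence "exp u \<le> 1 + u + u^2 * (1/2 + 4/30 + 16/25/24 + 279/125/120 * (4/5) * (16/25))"
    using t(2) 1 2 3 by (simp add: algebra_simps)
  also have "u^2 * (1/2 + 4/30 + 16/25/24 + 279/125/120 * (4/5) * (16/25)) \<le> u^2 * (27/40)"
    by (intro mult_left_mono) auto
  finally show ?thesis by (simp add: mult.commute)
qed

lemma exp_ge_cubic:
  fixes x :: real
  assumes "0 \<le> x"
  shows "1 + x + x\<^sup>2/2 + x^3/6 \<le> exp x"
proof -
  obtain t where t: "exp x = (\<Sum>m<4. x ^ m / fact m) + exp t / fact 4 * x ^ 4"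
    using Maclaurin_exp_le[of x 4] by blast
  have "(\<Sum>m<4. x ^ m / fact m) = 1 + x + x^2/2 + x^3/6"
    by (simp add: eval_nat_numeral algebra_simps)
  thus ?thesis using t assms by simp
qed

text \<open>Replacing the number that contains \<open>exp (-(4/5))\<close> by
  \<open>-69/100\<close>, multiplying by \<open>3 + 6 t\<close> and collecting \<open>exp t\<close>
  leaves \<open>3 + 6 t + 3.45 t^2 \<le> exp t * (3 + 3 t - t^2)\<close>. On
  \<open>t \<le> 2\<close> the last factor is nonnegative, and the cubic Taylor polynomial of
  \<open>exp t\<close> is good enough.\<close>

lemma entropy_ineq_endpoint:
  fixes t :: real
  assumes "0 < t" "t \<le> 2"
  shows "(t - 1) * exp t + 1 \<le> 5 * t\<^sup>2 / (3 + 6*t) * (exp t + (exp (-(4/5)) - 1) / (4/5))"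
proof -
  have "exp (-(4/5) :: real) \<ge> 448/1000"
  proof -
    have "(448/1000) * exp (4/5 :: real) \<le> 1" using exp_four_fifths_le by simp
    thus ?thesis by (simp add: exp_minus field_simps)
  qed
  hence e: "(exp (-(4/5)) - 1) / (4/5) \<ge> -(69/100 :: real)" by simp
  \<comment> \<open>The only negative term of the product below has degree five;
    \<open>t \<le> 2\<close> turns it into a cubic one that \<open>t^3\<close> absorbs.\<close>
  have t3: "t ^ 3 * t^2 \<le> t^3 * 4" using assms power_mono[of t 2 2] by (intro mult_left_mono) auto
  have "3/5 + 6/5 * t + 69/100 * t\<^sup>2
      \<le> (1 + t + t\<^sup>2/2 + t^3/6) * ((3 + 3*t - t\<^sup>2) / 5)"
  proof -
    have "(1 + t + t\<^sup>2/2 + t^3/6) * ((3 + 3*t - t\<^sup>2) / 5)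
        = (3 + 6*t + 7/2 * t\<^sup>2 + t^3 - t^3 * t^2/6) / 5"
      by (simp add: field_simps power2_eq_square power3_eq_cube)
    moreover have "0 \<le> t^2" "0 \<le> t^3" using assms by auto
    ultimately show ?thesis using t3 by argo
  qed
  also have "\<dots> \<le> exp t * ((3 + 3*t - t\<^sup>2) / 5)"
  proof (rule mult_right_mono)
    have "t^2 \<le> 2 * t" using assms by (simp add: power2_eq_square)
    thus "0 \<le> (3 + 3*t - t\<^sup>2) / 5" using assms by simp
  qed (use exp_ge_cubic[of t] assms in auto)
  finally have *: "(3 + 6*t) * ((t - 1) * exp t + 1) \<le> 5 * t\<^sup>2 * (exp t - 69/100)"
    by (simp add: field_simps power2_eq_square)
  have "(t - 1) * exp t + 1 \<le> 5 * t\<^sup>2 / (3 + 6*t) * (exp t - 69/100)"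
    using * assms by (simp add: field_simps)
  also have "\<dots> \<le> 5 * t\<^sup>2 / (3 + 6*t) * (exp t + (exp (-(4/5)) - 1) / (4/5))"
    using e assms by (intro mult_left_mono) auto
  finally show ?thesis .
qed

text \<open>
  The factor \<open>A = 5 t\<^sup>2 / (3 + 6 t)\<close> leads to \<open>t - A = t (3 + t) / (3 + 6 t)\<close>, with which the
  differential inequality for the logarithmic moment generating function integrates in closed form.
  The difference of the two sides has derivative \<open>exp (t w) k w\<close> with \<open>k\<close> concave and \<open>k 0 = 0\<close>, which
  leaves only the endpoint \<open>w = 1\<close> to be checked.
\<close>

lemma entropy_ineq:
  fixes t w :: real
  assumes t: "0 < t" "t \<le> 2" and w: "\<bar>w\<bar> \<le> 1"
  defines "A \<equiv> 5 * t\<^sup>2 / (3 + 6*t)"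
  shows "(t * w - 1) * exp (t * w) + 1
    \<le> A * (w * exp (t * w) + (exp (-(4/5) * w) - 1) / (4/5))"
proof -
  define g where "g w = A * (w * exp (t * w) + (exp (-(4/5) * w) - 1) / (4/5))
      - ((t * w - 1) * exp (t * w) + 1)" for w
  define k where "k w = A * (1 + t * w - exp (-(4/5 + t) * w)) - t\<^sup>2 * w" for w
  have A: "A > 0" unfolding A_def using t by simp
  have "t\<^sup>2 * (3 + 6*t) \<le> 5 * t\<^sup>2 * (2 * t + 4/5)"
    using t by (simp add: field_simps power2_eq_square)
  \<comment> \<open>This says that \<open>k\<close> has nonnegative slope at \<open>0\<close>. Hence
    \<open>k \<le> 0\<close> left of the origin, and \<open>g\<close> decreases there to
    \<open>g 0 = 0\<close>.\<close>
  hence A2: "t\<^sup>2 \<le> A * (2 * t + 4/5)"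
    using t unfolding A_def by (simp add: field_simps)
  have deriv: "(g has_real_derivative exp (t * w) * k w) (at w)" for w
  proof -
    have "exp (- (4/5 + t) * w) * exp (t * w) = exp (-(4/5) * w)"
      by (simp add: algebra_simps flip: exp_add)
    thus ?thesis
      unfolding g_def k_def
      by (auto intro!: derivative_eq_intros simp: algebra_simps power2_eq_square)
  qed
  have g0: "g 0 = 0" by (simp add: g_def)
  have g1: "0 \<le> g 1" using entropy_ineq_endpoint[OF t] by (simp add: g_def A_def)
  \<comment> \<open>In this form concavity locates the sign of \<open>k\<close> on the right:
    nonnegative at \<open>w\<close> implies nonnegative on \<open>[0, w]\<close>, negative at
    \<open>w\<close> implies nonpositive from \<open>w\<close> on. Accordingly \<open>g w\<close> is
    compared with \<open>g 0\<close> or with \<open>g 1\<close>.\<close>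
  have star: "\<theta> * k v \<le> k (\<theta> * v)" if "0 \<le> \<theta>" "\<theta> \<le> 1" for \<theta> v
  proof -
    have "exp ((1 - \<theta>) *\<^sub>R 0 + \<theta> *\<^sub>R (-(4/5 + t) * v))
        \<le> (1 - \<theta>) * exp 0 + \<theta> * exp (-(4/5 + t) * v)"
      using that by (intro convex_onD[OF exp_convex]) auto
    hence "exp (-(4/5 + t) * (\<theta> * v)) \<le> 1 - \<theta> + \<theta> * exp (-(4/5 + t) * v)"
      by (simp add: algebra_simps)
    hence "A * exp (-(4/5 + t) * (\<theta> * v)) \<le> A * (1 - \<theta> + \<theta> * exp (-(4/5 + t) * v))"
      using A by (intro mult_left_mono) auto
    thus ?thesis unfolding k_def by (simp add: algebra_simps)
  qed
  have "0 \<le> g w"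
  proof (cases "w \<le> 0")
    case True
    have "k v \<le> 0" if "v \<le> 0" for v
    proof -
      have "A * (1 + (-(4/5 + t) * v)) \<le> A * exp (-(4/5 + t) * v)"
        using A by (intro mult_left_mono exp_ge_add_one_self) auto
      moreover have "(A * (2 * t + 4/5) - t\<^sup>2) * v \<le> 0"
        using A2 that by (intro mult_nonneg_nonpos) auto
      ultimately show ?thesis unfolding k_def by (simp add: algebra_simps)
    qed
    hence "g 0 \<le> g w"
      using deriv True by (intro DERIV_nonpos_imp_nonincreasing[of w 0 g])
        (auto intro!: exI mult_nonneg_nonpos)
    thus ?thesis using g0 by simp
  next
    case False
    show ?thesis
    proof (cases "0 \<le> k w")
      case True
      have "0 \<le> k v" if "0 \<le> v" "v \<le> w" for v
      proof -
        have "0 \<le> v / w * k w" using True that by simp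
        also have "\<dots> \<le> k v" using star[of "v / w" w] that False by simp
        finally show ?thesis .
      qed
      hence "g 0 \<le> g w"
        using deriv False by (intro DERIV_nonneg_imp_nondecreasing[of 0 w g])
          (auto intro!: exI mult_nonneg_nonneg)
      thus ?thesis using g0 by simp
    next
      case neg: False
      have "k v \<le> 0" if "w \<le> v" for v
      proof (rule ccontr)
        assume "\<not> k v \<le> 0"
        hence "0 \<le> w / v * k v" using that False by simp
        also have "\<dots> \<le> k w" using star[of "w / v" v] that False by simp
        finally show False using neg by simp
      qed
      hence "g 1 \<le> g w"
        using deriv w by (intro DERIV_nonpos_imp_nonincreasing[of w 1 g])
          (auto intro!: exI mult_nonneg_nonpos)
      thus ?thesis using g1 by simp
    qed
  qed
  thus ?thesis by (simp add: g_def)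
qed

section \<open>Entropy\<close>

definition functional_entropy :: "'a measure \<Rightarrow> ('a \<Rightarrow> real) \<Rightarrow> real" where
  "functional_entropy M f = (\<integral>x. f x * ln (f x) \<partial>M) - (\<integral>x. f x \<partial>M) * ln (\<integral>x. f x \<partial>M)"

section \<open>Bounded functions on a probability space\<close>

lemma (in prob_space) integrable_bounded:
  fixes f :: "'a \<Rightarrow> real"
  assumes "f \<in> borel_measurable M" "\<And>x. x \<in> space M \<Longrightarrow> \<bar>f x\<bar> \<le> B"
  shows "integrable M f"
  using assms by (intro integrable_const_bound[where B = B]) auto

lemma (in prob_space) integral_between:
  fixes f :: "'a \<Rightarrow> real"
  assumes "f \<in> borel_measurable M" "\<And>x. x \<in> space M \<Longrightarrow> l \<le> f x" "\<And>x. x \<in> space M \<Longrightarrow> f x \<le> u"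
  shows "l \<le> integral\<^sup>L M f" "integral\<^sup>L M f \<le> u"
proof -
  have "integrable M f"
    using assms by (intro integrable_bounded[where B = "max \<bar>l\<bar> \<bar>u\<bar>"]) force+
  thus "l \<le> integral\<^sup>L M f" "integral\<^sup>L M f \<le> u"
    using assms by (auto intro!: integral_ge_const integral_le_const)
qed

lemma (in prob_space) abs_integral_le:
  fixes f :: "'a \<Rightarrow> real"
  assumes "f \<in> borel_measurable M" "\<And>x. x \<in> space M \<Longrightarrow> \<bar>f x\<bar> \<le> B"
  shows "\<bar>integral\<^sup>L M f\<bar> \<le> B"
proof -
  have "- B \<le> f x" "f x \<le> B" if "x \<in> space M" for x using assms(2)[OF that] by auto
  from integral_between[OF assms(1) this] show ?thesis by auto
qed

lemma abs_ln_le: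
  fixes l u y :: real
  assumes "0 < l" "l \<le> y" "y \<le> u"
  shows "\<bar>ln y\<bar> \<le> \<bar>ln l\<bar> + \<bar>ln u\<bar>"
proof -
  have "ln l \<le> ln y" "ln y \<le> ln u" using assms by auto
  thus ?thesis by linarith
qed

lemma (in prob_space) functional_entropy_abs_le:
  assumes f: "f \<in> borel_measurable M" "\<And>x. x \<in> space M \<Longrightarrow> l \<le> f x" "\<And>x. x \<in> space M \<Longrightarrow> f x \<le> u"
    and l: "0 < l"
  shows "\<bar>functional_entropy M f\<bar> \<le> 2 * (u * (\<bar>ln l\<bar> + \<bar>ln u\<bar>))"
proof -
  have "\<bar>y * ln y\<bar> \<le> u * (\<bar>ln l\<bar> + \<bar>ln u\<bar>)" if "l \<le> y" "y \<le> u" for y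
    using that l abs_ln_le[of l y u] unfolding abs_mult by (intro mult_mono) auto
  note b = this
  have "\<bar>\<integral>x. f x * ln (f x) \<partial>M\<bar> \<le> u * (\<bar>ln l\<bar> + \<bar>ln u\<bar>)"
    using f b by (intro abs_integral_le) auto
  moreover have "\<bar>integral\<^sup>L M f * ln (integral\<^sup>L M f)\<bar> \<le> u * (\<bar>ln l\<bar> + \<bar>ln u\<bar>)"
    using integral_between[OF f] b by blast
  ultimately show ?thesis unfolding functional_entropy_def by linarith
qed

lemma (in sigma_finite_measure) borel_measurable_functional_entropy[measurable (raw)]:
  assumes [measurable]: "case_prod f \<in> borel_measurable (N \<Otimes>\<^sub>M M)"
  shows "(\<lambda>x. functional_entropy M (f x)) \<in> borel_measurable N"
  unfolding functional_entropy_def by measurable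

text \<open>The Gibbs variational inequality, obtained by integrating
  \<open>ln u \<le> u - 1\<close> at \<open>u = h m / (c f)\<close>, where \<open>m\<close> and
  \<open>c\<close> are the means of \<open>f\<close> and \<open>h\<close>. Its left side is linear
  in \<open>f\<close>, which later yields the convexity of the entropy.\<close>

lemma (in prob_space) functional_entropy_ge:
  assumes f[measurable]: "f \<in> borel_measurable M"
    and fl: "\<And>x. x \<in> space M \<Longrightarrow> l \<le> f x" and fu: "\<And>x. x \<in> space M \<Longrightarrow> f x \<le> u"
    and h[measurable]: "h \<in> borel_measurable M"
    and hl: "\<And>x. x \<in> space M \<Longrightarrow> l \<le> h x" and hu: "\<And>x. x \<in> space M \<Longrightarrow> h x \<le> u"
    and l: "0 < l"
  shows "(\<integral>x. f x * ln (h x) \<partial>M) - (\<integral>x. f x \<partial>M) * ln (\<integral>x. h x \<partial>M) \<le> functional_entropy M f"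
proof -
  define m c where "m = integral\<^sup>L M f" and "c = integral\<^sup>L M h"
  have m: "m \<ge> l" and c: "c \<ge> l"
    using integral_between[of f l u] integral_between[of h l u] fl fu hl hu by (auto simp: m_def c_def)
  have b: "\<bar>y * ln z\<bar> \<le> u * (\<bar>ln l\<bar> + \<bar>ln u\<bar>)" if "l \<le> y" "y \<le> u" "l \<le> z" "z \<le> u" for y z
    using that l abs_ln_le[of l z u] unfolding abs_mult by (intro mult_mono) auto
  have abs: "\<bar>f x\<bar> \<le> u" "\<bar>h x\<bar> \<le> u" if "x \<in> space M" for x
    using fl[OF that] fu[OF that] hl[OF that] hu[OF that] l by auto
  have int: "integrable M f" "integrable M h"
    by (rule integrable_bounded[where B = u]; use abs in simp)+
  have int_ln: "integrable M (\<lambda>x. f x * ln (h x))" "integrable M (\<lambda>x. f x * ln (f x))"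
    by (rule integrable_bounded[where B = "u * (\<bar>ln l\<bar> + \<bar>ln u\<bar>)"]; use fl fu hl hu in \<open>auto intro!: b\<close>)+
  note int = int int_ln
  have "(\<integral>x. f x * ln (h x) - f x * ln c - f x * ln (f x) + f x * ln m \<partial>M) \<le> (\<integral>x. h x * (m / c) - f x \<partial>M)"
  proof (intro integral_mono)
    fix x assume x: "x \<in> space M"
    have pos: "f x > 0" "h x > 0" "m > 0" "c > 0" using fl[OF x] hl[OF x] l m c by auto
    have "ln (h x * m / (c * f x)) \<le> h x * m / (c * f x) - 1"
      using pos by (intro ln_le_minus_one) auto
    moreover have "ln (h x * m / (c * f x)) = ln (h x) + ln m - ln c - ln (f x)"
      using pos by (simp add: ln_mult ln_div)
    ultimately have "f x * (ln (h x) + ln m - ln c - ln (f x)) \<le> f x * (h x * m / (c * f x) - 1)"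
      using pos by (intro mult_left_mono) auto
    also have "\<dots> = h x * (m / c) - f x" using pos by (simp add: field_simps)
    finally show "f x * ln (h x) - f x * ln c - f x * ln (f x) + f x * ln m \<le> h x * (m / c) - f x"
      by (simp add: algebra_simps)
  qed (use int in auto)
  also have "\<dots> = c * (m / c) - m" using int by (simp add: m_def c_def)
  also have "\<dots> = 0" using c l by simp
  finally show ?thesis
    using int by (simp add: functional_entropy_def m_def c_def)
qed

text \<open>The tangent of \<open>y * ln y\<close> at \<open>c\<close> lies below the function, so
  \<open>m * ln m \<ge> m * ln c + m - c\<close> at the mean \<open>m\<close>. The point
  \<open>c\<close> stays free in order to be matched with the soft minimum.\<close>

lemma (in prob_space) functional_entropy_le:
  assumes f[measurable]: "f \<in> borel_measurable M"
    and fl: "\<And>x. x \<in> space M \<Longrightarrow> l \<le> f x" and fu: "\<And>x. x \<in> space M \<Longrightarrow> f x \<le> u"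
    and l: "0 < l" and c: "0 < c"
  shows "functional_entropy M f \<le> (\<integral>x. f x * ln (f x) - f x * ln c - f x + c \<partial>M)"
proof -
  define m where "m = integral\<^sup>L M f"
  have m: "m > 0"
    using integral_between[of f l u] fl fu l by (auto simp: m_def)
  have b: "\<bar>y * ln y\<bar> \<le> u * (\<bar>ln l\<bar> + \<bar>ln u\<bar>)" if "l \<le> y" "y \<le> u" for y
    using that l abs_ln_le[of l y u] unfolding abs_mult by (intro mult_mono) auto
  have int: "integrable M f"
    using fl fu l by (intro integrable_bounded[where B = u]) force+
  have int_ln: "integrable M (\<lambda>x. f x * ln (f x))"
    by (rule integrable_bounded[where B = "u * (\<bar>ln l\<bar> + \<bar>ln u\<bar>)"]; use fl fu in \<open>auto intro!: b\<close>)
  note int = int int_ln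
  have "ln (c / m) \<le> c / m - 1" using m c by (intro ln_le_minus_one) auto
  hence "m * (ln c - ln m) \<le> m * (c / m - 1)" using m c by (intro mult_left_mono) (auto simp: ln_div)
  also have "\<dots> = c - m" using m by (simp add: field_simps)
  finally have "m * ln c + m - c \<le> m * ln m" by (simp add: algebra_simps)
  moreover have "(\<integral>x. f x * ln (f x) - f x * ln c - f x + c \<partial>M) = (\<integral>x. f x * ln (f x) \<partial>M) - m * ln c - m + c"
    using int by (simp add: m_def prob_space)
  ultimately show ?thesis by (simp add: functional_entropy_def m_def)
qed

text \<open>
  If \<open>c + g \<le> Z\<close> with \<open>g\<close> centered, then \<open>c\<close> exceeds the soft minimum of \<open>Z\<close> by at most a multiple of
  the variance of \<open>g\<close>. The parameter \<open>4/5\<close> balances this multiple against the constant in the entropy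
  inequality below.
\<close>

definition soft_min :: "'a measure \<Rightarrow> ('a \<Rightarrow> real) \<Rightarrow> real" where
  "soft_min M Z = - ln (\<integral>x. exp (-(4/5) * Z x) \<partial>M) / (4/5)"

lemma (in prob_space) soft_min_bounds:
  fixes Z :: "'a \<Rightarrow> real"
  assumes [measurable]: "Z \<in> borel_measurable M"
    and "\<And>x. x \<in> space M \<Longrightarrow> l \<le> Z x" "\<And>x. x \<in> space M \<Longrightarrow> Z x \<le> u"
  shows "l \<le> soft_min M Z" "soft_min M Z \<le> u" "exp (-(4/5) * soft_min M Z) = (\<integral>x. exp (-(4/5) * Z x) \<partial>M)"
proof -
  let ?m = "\<integral>x. exp (-(4/5) * Z x) \<partial>M"
  have m: "exp (-(4/5) * u) \<le> ?m" "?m \<le> exp (-(4/5) * l)"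
    using assms integral_between[of "\<lambda>x. exp (-(4/5) * Z x)" "exp (-(4/5) * u)" "exp (-(4/5) * l)"] by auto
  hence pos: "?m > 0" using exp_gt_zero less_le_trans by blast
  have "-(4/5) * u \<le> ln ?m" "ln ?m \<le> -(4/5) * l"
    using m pos by (metis exp_le_cancel_iff exp_ln)+
  thus "l \<le> soft_min M Z" "soft_min M Z \<le> u" by (auto simp: soft_min_def field_simps)
  show "exp (-(4/5) * soft_min M Z) = ?m"
    using pos by (simp add: soft_min_def)
qed

text \<open>The choice \<open>c = exp (t * z)\<close> in \<open>functional_entropy_le\<close> turns
  the integrand into \<open>exp (t * z)\<close> times the left side of \<open>entropy_ineq\<close>
  at \<open>w = Z x - z\<close>. On the right side of that inequality the term with
  \<open>exp (-(4/5) * w) - 1\<close> integrates to zero, which is exactly the equation defining the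
  soft minimum \<open>z\<close>.\<close>

lemma (in prob_space) functional_entropy_exp_le:
  fixes Z :: "'a \<Rightarrow> real"
  assumes [measurable]: "Z \<in> borel_measurable M"
    and osc: "\<And>x y. x \<in> space M \<Longrightarrow> y \<in> space M \<Longrightarrow> Z x - Z y \<le> 1"
    and t: "0 < t" "t \<le> 2"
  shows "functional_entropy M (\<lambda>x. exp (t * Z x))
    \<le> 5 * t\<^sup>2 / (3 + 6*t) * (\<integral>x. exp (t * Z x) * (Z x - soft_min M Z) \<partial>M)"
proof -
  define A where "A = 5 * t\<^sup>2 / (3 + 6*t)"
  define z where "z = soft_min M Z"
  obtain x0 where x0: "x0 \<in> space M" using not_empty by auto
  define l u where "l = Z x0 - 1" and "u = Z x0 + 1"
  have lu: "l \<le> Z x" "Z x \<le> u" if "x \<in> space M" for x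
    using osc[OF that x0] osc[OF x0 that] by (auto simp: l_def u_def)
  have w: "\<bar>Z x - z\<bar> \<le> 1" if "x \<in> space M" for x
    using soft_min_bounds[of Z "Z x - 1" "Z x + 1"] osc[OF that] osc[OF _ that]
    by (fastforce simp: z_def)
  have zK: "exp (-(4/5) * z) = (\<integral>x. exp (-(4/5) * Z x) \<partial>M)"
    unfolding z_def using lu by (intro soft_min_bounds(3)[of Z l u]) auto
  have tlu: "exp (t * l) \<le> exp (t * Z x)" "exp (t * Z x) \<le> exp (t * u)" if "x \<in> space M" for x
    using lu[OF that] t by auto
  have int: "integrable M (\<lambda>x. exp (t * Z x))"
    using tlu by (intro integrable_bounded[where B = "exp (t * u)"]) auto
  have int': "integrable M (\<lambda>x. exp (-(4/5) * Z x))"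
    using lu by (intro integrable_bounded[where B = "exp (-(4/5) * l)"]) auto
  note int = int int'
  have intw: "integrable M (\<lambda>x. exp (t * Z x) * (Z x - z))"
  proof (rule integrable_bounded[where B = "exp (t * u) * 1"])
    fix x assume "x \<in> space M"
    thus "\<bar>exp (t * Z x) * (Z x - z)\<bar> \<le> exp (t * u) * 1"
      unfolding abs_mult using w tlu by (intro mult_mono) auto
  qed simp
  have "functional_entropy M (\<lambda>x. exp (t * Z x))
      \<le> (\<integral>x. exp (t * Z x) * ln (exp (t * Z x)) - exp (t * Z x) * ln (exp (t * z)) - exp (t * Z x) + exp (t * z) \<partial>M)"
    using tlu by (intro functional_entropy_le[where l = "exp (t * l)" and u = "exp (t * u)"]) auto
  also have "\<dots> = (\<integral>x. t * (exp (t * Z x) * (Z x - z)) - exp (t * Z x) + exp (t * z) \<partial>M)"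
    by (simp add: algebra_simps)
  also have "\<dots> \<le> (\<integral>x. A * (exp (t * Z x) * (Z x - z))
      + A * exp (t * z) / (4/5) * (exp (4/5 * z) * exp (-(4/5) * Z x) - 1) \<partial>M)"
  proof (intro integral_mono)
    fix x assume x: "x \<in> space M"
    define v E e q where "v = Z x - z" and "E = exp (t * z)" and "e = exp (t * v)"
      and "q = exp (-(4/5) * v)"
    have "E * ((t * v - 1) * e + 1) \<le> E * (A * (v * e + (q - 1) / (4/5)))"
      unfolding A_def E_def e_def q_def v_def
      by (intro mult_left_mono entropy_ineq t w x) auto
    moreover have "exp (t * Z x) = E * e"
      by (simp add: E_def e_def v_def algebra_simps flip: exp_add)
    moreover have "exp (4/5 * z) * exp (-(4/5) * Z x) = q"
      by (simp add: q_def v_def field_simps flip: exp_add)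
    ultimately show "t * (exp (t * Z x) * (Z x - z)) - exp (t * Z x) + exp (t * z)
        \<le> A * (exp (t * Z x) * (Z x - z)) + A * exp (t * z) / (4/5) * (exp (4/5 * z) * exp (-(4/5) * Z x) - 1)"
      unfolding v_def[symmetric] E_def[symmetric] by (simp add: algebra_simps)
  qed (use int intw in auto)
  also have "\<dots> = A * (\<integral>x. exp (t * Z x) * (Z x - z) \<partial>M)
      + A * exp (t * z) / (4/5) * (exp (4/5 * z) * exp (-(4/5) * z) - 1)"
    unfolding zK using int intw by (simp add: prob_space)
  also have "exp (4/5 * z) * exp (-(4/5) * z) = 1"
    by (simp flip: exp_add)
  finally show ?thesis by (simp add: A_def z_def)
qed

text \<open>Convexity of the entropy: the variational inequality is used with the same test function
  \<open>G\<close> for every \<open>y\<close>. Integrating over \<open>y\<close> and exchanging the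
  integrals turns its left side into the entropy of \<open>G\<close>.\<close>

lemma (in pair_prob_space) functional_entropy_integral_le:
  fixes F :: "'a \<Rightarrow> 'b \<Rightarrow> real"
  assumes [measurable]: "case_prod F \<in> borel_measurable (M1 \<Otimes>\<^sub>M M2)"
    and Fl: "\<And>x y. x \<in> space M1 \<Longrightarrow> y \<in> space M2 \<Longrightarrow> l \<le> F x y"
    and Fu: "\<And>x y. x \<in> space M1 \<Longrightarrow> y \<in> space M2 \<Longrightarrow> F x y \<le> u"
    and l: "0 < l"
  shows "functional_entropy M1 (\<lambda>x. \<integral>y. F x y \<partial>M2) \<le> (\<integral>y. functional_entropy M1 (\<lambda>x. F x y) \<partial>M2)"
proof -
  define G where "G x = (\<integral>y. F x y \<partial>M2)" for x
  define B where "B = u * (\<bar>ln l\<bar> + \<bar>ln u\<bar>)"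
  have [measurable]: "G \<in> borel_measurable M1" unfolding G_def by measurable
  have Gl: "l \<le> G x" "G x \<le> u" if "x \<in> space M1" for x
    unfolding G_def using that Fl Fu by (auto intro!: M2.integral_between)
  have absF: "\<bar>F x y\<bar> \<le> u" "\<bar>F x y * ln (G x)\<bar> \<le> B" if "x \<in> space M1" "y \<in> space M2" for x y
  proof -
    note b = Fl[OF that] Fu[OF that] Gl[OF that(1)]
    show "\<bar>F x y\<bar> \<le> u" using b l by auto
    show "\<bar>F x y * ln (G x)\<bar> \<le> B"
      unfolding B_def abs_mult using b l abs_ln_le[of l "G x" u] by (intro mult_mono) auto
  qed
  define c where "c = (\<integral>x. G x \<partial>M1)"
  have intF: "integrable (M1 \<Otimes>\<^sub>M M2) (case_prod F)"
    using absF by (intro integrable_bounded[where B = u]) (auto simp: space_pair_measure)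
  have intG: "integrable (M1 \<Otimes>\<^sub>M M2) (\<lambda>(x, y). F x y * ln (G x))"
    using absF by (intro integrable_bounded[where B = B]) (auto simp: space_pair_measure)
  have "functional_entropy M1 G = (\<integral>x. (\<integral>y. F x y * ln (G x) \<partial>M2) \<partial>M1) - (\<integral>x. (\<integral>y. F x y \<partial>M2) \<partial>M1) * ln c"
    by (simp add: functional_entropy_def G_def c_def)
  also have "\<dots> = (\<integral>y. (\<integral>x. F x y * ln (G x) \<partial>M1) \<partial>M2) - (\<integral>y. (\<integral>x. F x y \<partial>M1) \<partial>M2) * ln c"
    using Fubini_integral[OF intF] Fubini_integral[OF intG] by simp
  also have "\<dots> = (\<integral>y. (\<integral>x. F x y * ln (G x) \<partial>M1) - (\<integral>x. F x y \<partial>M1) * ln c \<partial>M2)"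
    using integrable_snd[OF intF] integrable_snd[OF intG] by simp
  also have "\<dots> \<le> (\<integral>y. functional_entropy M1 (\<lambda>x. F x y) \<partial>M2)"
  proof (intro integral_mono)
    show "integrable M2 (\<lambda>y. functional_entropy M1 (\<lambda>x. F x y))"
      using Fl Fu l
      by (intro M2.integrable_bounded[where B = "2 * (u * (\<bar>ln l\<bar> + \<bar>ln u\<bar>))"])
        (auto intro!: M1.functional_entropy_abs_le)
    show "(\<integral>x. F x y * ln (G x) \<partial>M1) - (\<integral>x. F x y \<partial>M1) * ln c \<le> functional_entropy M1 (\<lambda>x. F x y)"
      if "y \<in> space M2" for y
      unfolding c_def using Fl Fu Gl l that by (intro M1.functional_entropy_ge) auto
  qed (use integrable_snd[OF intF] integrable_snd[OF intG] in auto)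
  finally show ?thesis unfolding G_def .
qed

section \<open>Replacing one coordinate in a product space\<close>

lemma (in product_prob_space) integral_bounded_insert:
  fixes f :: "('i \<Rightarrow> 'a) \<Rightarrow> real"
  assumes "finite J" "i \<notin> J" "f \<in> borel_measurable (PiM (insert i J) M)"
    "\<And>x. x \<in> space (PiM (insert i J) M) \<Longrightarrow> \<bar>f x\<bar> \<le> B"
  shows "integral\<^sup>L (PiM (insert i J) M) f = (\<integral>x. (\<integral>y. f (x(i := y)) \<partial>M i) \<partial>PiM J M)"
proof -
  interpret PJ: prob_space "PiM (insert i J) M" by (rule prob_space_PiM) (rule prob_space)
  show ?thesis using assms by (intro product_integral_insert PJ.integrable_bounded) auto
qed

lemma measurable_fun_upd_PiM:
  assumes "i \<in> J"
  shows "(\<lambda>(x, y). x(i := y)) \<in> PiM J M \<Otimes>\<^sub>M M i \<rightarrow>\<^sub>M PiM J M"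
  using measurable_add_dim[of i J M] assms by (simp add: insert_absorb)

lemma fun_upd_space_PiM:
  assumes "x \<in> space (PiM J M)" "y \<in> space (M i)"
  shows "x(i := y) \<in> space (PiM (insert i J) M)"
  using assms by (auto simp: space_PiM PiE_def extensional_def)

text \<open>The old entry of \<open>x\<close> at \<open>i\<close> is overwritten, so integrating
  over it as well costs nothing. Partial integrals for different \<open>i\<close> thus live on one
  common space and can be summed.\<close>

lemma (in product_prob_space) integral_resample:
  fixes f :: "('i \<Rightarrow> 'a) \<Rightarrow> real"
  assumes J: "finite J" "i \<in> J" and f[measurable]: "f \<in> borel_measurable (PiM J M)"
    and B: "\<And>x. x \<in> space (PiM J M) \<Longrightarrow> \<bar>f x\<bar> \<le> B"
  shows "integral\<^sup>L (PiM J M) f = (\<integral>x. (\<integral>y. f (x(i := y)) \<partial>M i) \<partial>PiM J M)"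
proof -
  define J' where "J' = J - {i}"
  have J': "finite J'" "i \<notin> J'" "J = insert i J'" using J by (auto simp: J'_def)
  have [measurable]: "(\<lambda>(x, y). x(i := y)) \<in> PiM J M \<Otimes>\<^sub>M M i \<rightarrow>\<^sub>M PiM J M"
    using J by (rule_tac measurable_fun_upd_PiM)
  have upd: "x(i := y) \<in> space (PiM J M)" if "x \<in> space (PiM J M)" "y \<in> space (M i)" for x y
    using fun_upd_space_PiM[OF that] J by (simp add: insert_absorb)
  have "(\<integral>x. (\<integral>y. f (x(i := y)) \<partial>M i) \<partial>PiM J M)
      = (\<integral>x. (\<integral>y'. (\<integral>y. f ((x(i := y'))(i := y)) \<partial>M i) \<partial>M i) \<partial>PiM J' M)"
    unfolding J'(3)
  proof (rule integral_bounded_insert[OF J'(1,2), where B = B])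
    fix x assume x: "x \<in> space (PiM (insert i J') M)"
    show "\<bar>\<integral>y. f (x(i := y)) \<partial>M i\<bar> \<le> B"
      using x B upd J'(3) by (intro M.abs_integral_le) auto
  qed (simp flip: J'(3))
  also have "\<dots> = integral\<^sup>L (PiM J M) f"
    using integral_bounded_insert[OF J'(1,2), of f B] f B by (simp add: M.prob_space flip: J'(3))
  finally show ?thesis ..
qed

text \<open>Induction on the chain rule: the entropy is the mean of the entropy in coordinate
  \<open>i\<close> plus the entropy of the partial integral \<open>g\<close>. The induction
  hypothesis handles \<open>g\<close>, and convexity pulls the integral over coordinate
  \<open>i\<close> out of each remaining entropy.\<close>

lemma (in product_prob_space) functional_entropy_tensorization:
  fixes f :: "('i \<Rightarrow> 'a) \<Rightarrow> real"
  assumes "finite J" "f \<in> borel_measurable (PiM J M)"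
    and "\<And>x. x \<in> space (PiM J M) \<Longrightarrow> l \<le> f x" "\<And>x. x \<in> space (PiM J M) \<Longrightarrow> f x \<le> u"
    and l: "0 < l"
  shows "functional_entropy (PiM J M) f
    \<le> (\<Sum>i\<in>J. \<integral>x. functional_entropy (M i) (\<lambda>y. f (x(i := y))) \<partial>PiM J M)"
  using assms(1-4)
proof (induction J arbitrary: f rule: finite_induct)
  case empty
  show ?case
    by (simp add: functional_entropy_def PiM_empty lebesgue_integral_count_space_finite)
next
  case (insert i J f)
  note [measurable] = insert.prems(1)
  interpret PJ: prob_space "PiM J M" by (rule prob_space_PiM) (rule prob_space)
  define B where "B = 2 * (u * (\<bar>ln l\<bar> + \<bar>ln u\<bar>))"
  have upd: "x(i := y) \<in> space (PiM (insert i J) M)" if "x \<in> space (PiM J M)" "y \<in> space (M i)" for x y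
    using that by (rule fun_upd_space_PiM)
  have fl: "l \<le> f (x(i := y))" "f (x(i := y)) \<le> u" if "x \<in> space (PiM J M)" "y \<in> space (M i)" for x y
    using insert.prems upd that by auto
  define g where "g x = (\<integral>y. f (x(i := y)) \<partial>M i)" for x
  have [measurable]: "g \<in> borel_measurable (PiM J M)"
    unfolding g_def by measurable
  have gl: "l \<le> g x" "g x \<le> u" if "x \<in> space (PiM J M)" for x
    unfolding g_def using that fl by (auto intro!: M.integral_between)
  have absy: "\<bar>y * ln y\<bar> \<le> u * (\<bar>ln l\<bar> + \<bar>ln u\<bar>)" if "l \<le> y" "y \<le> u" for y
    using that l abs_ln_le[of l y u] unfolding abs_mult by (intro mult_mono) auto
  have entb: "\<bar>functional_entropy (M i) (\<lambda>y. f (x(i := y)))\<bar> \<le> B" if "x \<in> space (PiM J M)" for x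
    unfolding B_def using that fl l by (intro M.functional_entropy_abs_le) auto
  have int_ent: "integrable (PiM J M) (\<lambda>x. functional_entropy (M i) (\<lambda>y. f (x(i := y))))"
    using entb by (intro PJ.integrable_bounded[where B = B]) auto
  have int_g: "integrable (PiM J M) (\<lambda>x. g x * ln (g x))"
    using gl by (intro PJ.integrable_bounded[where B = "u * (\<bar>ln l\<bar> + \<bar>ln u\<bar>)"] absy) auto
  have "(\<integral>x. f x * ln (f x) \<partial>PiM (insert i J) M)
      = (\<integral>x. (\<integral>y. f (x(i := y)) * ln (f (x(i := y))) \<partial>M i) \<partial>PiM J M)"
    using insert.hyps insert.prems
    by (intro integral_bounded_insert[where B = "u * (\<bar>ln l\<bar> + \<bar>ln u\<bar>)"] absy) auto
  also have "\<dots> = (\<integral>x. functional_entropy (M i) (\<lambda>y. f (x(i := y))) + g x * ln (g x) \<partial>PiM J M)"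
    by (simp add: functional_entropy_def g_def)
  also have "\<dots> = (\<integral>x. functional_entropy (M i) (\<lambda>y. f (x(i := y))) \<partial>PiM J M) + (\<integral>x. g x * ln (g x) \<partial>PiM J M)"
    using int_ent int_g by simp
  finally have 1: "(\<integral>x. f x * ln (f x) \<partial>PiM (insert i J) M)
      = (\<integral>x. functional_entropy (M i) (\<lambda>y. f (x(i := y))) \<partial>PiM J M) + (\<integral>x. g x * ln (g x) \<partial>PiM J M)" .
  have absf: "\<bar>f x\<bar> \<le> u" if "x \<in> space (PiM (insert i J) M)" for x
    using insert.prems that l by force
  have 2: "integral\<^sup>L (PiM (insert i J) M) f = integral\<^sup>L (PiM J M) g"
    unfolding g_def using insert.hyps absf by (intro integral_bounded_insert) auto
  have 3: "functional_entropy (PiM (insert i J) M) f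
      = (\<integral>x. functional_entropy (M i) (\<lambda>y. f (x(i := y))) \<partial>PiM J M) + functional_entropy (PiM J M) g"
    unfolding functional_entropy_def[of "PiM _ _"] 1 2 by simp
  have "functional_entropy (PiM J M) g
      \<le> (\<Sum>k\<in>J. \<integral>x. functional_entropy (M k) (\<lambda>y. g (x(k := y))) \<partial>PiM J M)"
    using gl by (intro insert.IH) auto
  also have "\<dots> \<le> (\<Sum>k\<in>J. \<integral>x. functional_entropy (M k) (\<lambda>y. f (x(k := y))) \<partial>PiM (insert i J) M)"
  proof (rule sum_mono)
    fix k assume k: "k \<in> J"
    hence ki: "k \<noteq> i" using insert.hyps by auto
    have mk[measurable]: "(\<lambda>(x, y). x(k := y)) \<in> PiM J M \<Otimes>\<^sub>M M k \<rightarrow>\<^sub>M PiM J M"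
      using k by (rule measurable_fun_upd_PiM)
    have mk'[measurable]: "(\<lambda>(x, y). x(k := y)) \<in> PiM (insert i J) M \<Otimes>\<^sub>M M k \<rightarrow>\<^sub>M PiM (insert i J) M"
      using k by (intro measurable_fun_upd_PiM) auto
    have updk: "x(k := y) \<in> space (PiM J M)" if "x \<in> space (PiM J M)" "y \<in> space (M k)" for x y
      using fun_upd_space_PiM[OF that] k by (simp add: insert_absorb)
    have updk': "x(k := y) \<in> space (PiM (insert i J) M)" if "x \<in> space (PiM (insert i J) M)" "y \<in> space (M k)" for x y
      using fun_upd_space_PiM[OF that] k by (simp add: insert_absorb insert_commute)
    have entk: "\<bar>functional_entropy (M k) (\<lambda>y. f (x(k := y)))\<bar> \<le> B" if "x \<in> space (PiM (insert i J) M)" for x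
      unfolding B_def using that insert.prems l updk' by (intro M.functional_entropy_abs_le) auto
    have "(\<integral>x. functional_entropy (M k) (\<lambda>y. g (x(k := y))) \<partial>PiM J M)
        \<le> (\<integral>x. (\<integral>y'. functional_entropy (M k) (\<lambda>y. f (x(i := y', k := y))) \<partial>M i) \<partial>PiM J M)"
    proof (rule integral_mono)
      show "integrable (PiM J M) (\<lambda>x. functional_entropy (M k) (\<lambda>y. g (x(k := y))))"
        using gl updk l
        by (intro PJ.integrable_bounded[where B = B])
          (auto simp: B_def intro!: M.functional_entropy_abs_le)
      show "integrable (PiM J M) (\<lambda>x. \<integral>y'. functional_entropy (M k) (\<lambda>y. f (x(i := y', k := y))) \<partial>M i)"
        using entk upd
        by (intro PJ.integrable_bounded[where B = B])
          (auto intro!: M.abs_integral_le)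
      fix x assume x: "x \<in> space (PiM J M)"
      \<comment> \<open>With \<open>x\<close> fixed only the coordinates \<open>k\<close> and
        \<open>i\<close> vary, so convexity is applied on this pair of factors; the two updates
        commute because \<open>k\<close> differs from \<open>i\<close>.\<close>
      interpret Q: pair_prob_space "M k" "M i" by unfold_locales
      have [measurable]: "(\<lambda>(y, y'). x(k := y, i := y')) \<in> M k \<Otimes>\<^sub>M M i \<rightarrow>\<^sub>M PiM (insert i J) M"
      proof -
        have [measurable]: "(\<lambda>y. x(k := y)) \<in> M k \<rightarrow>\<^sub>M PiM J M"
          using measurable_Pair2[OF mk x] by simp
        show ?thesis by measurable
      qed
      have "functional_entropy (M k) (\<lambda>y. \<integral>y'. f (x(k := y, i := y')) \<partial>M i)
          \<le> (\<integral>y'. functional_entropy (M k) (\<lambda>y. f (x(k := y, i := y'))) \<partial>M i)"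
        using fl updk x l by (intro Q.functional_entropy_integral_le[where l = l and u = u]) auto
      thus "functional_entropy (M k) (\<lambda>y. g (x(k := y)))
          \<le> (\<integral>y'. functional_entropy (M k) (\<lambda>y. f (x(i := y', k := y))) \<partial>M i)"
        using ki by (simp add: g_def fun_upd_twist)
    qed
    also have "\<dots> = (\<integral>x. functional_entropy (M k) (\<lambda>y. f (x(k := y))) \<partial>PiM (insert i J) M)"
      using insert.hyps entk by (intro integral_bounded_insert[symmetric]) auto
    finally show "(\<integral>x. functional_entropy (M k) (\<lambda>y. g (x(k := y))) \<partial>PiM J M)
      \<le> (\<integral>x. functional_entropy (M k) (\<lambda>y. f (x(k := y))) \<partial>PiM (insert i J) M)" .
  qed
  finally have 4: "functional_entropy (PiM J M) g
      \<le> (\<Sum>k\<in>J. \<integral>x. functional_entropy (M k) (\<lambda>y. f (x(k := y))) \<partial>PiM (insert i J) M)" .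
  \<comment> \<open>The section entropy ignores the old entry at \<open>i\<close>, so this
    coordinate may be added to the outer integral.\<close>
  have 5: "(\<integral>x. functional_entropy (M i) (\<lambda>y. f (x(i := y))) \<partial>PiM J M)
      = (\<integral>x. functional_entropy (M i) (\<lambda>y. f (x(i := y))) \<partial>PiM (insert i J) M)"
  proof -
    have mi[measurable]: "(\<lambda>(x, y). x(i := y)) \<in> PiM (insert i J) M \<Otimes>\<^sub>M M i \<rightarrow>\<^sub>M PiM (insert i J) M"
      by (rule measurable_fun_upd_PiM) simp
    have updi: "x(i := y) \<in> space (PiM (insert i J) M)" if "x \<in> space (PiM (insert i J) M)" "y \<in> space (M i)" for x y
      using fun_upd_space_PiM[OF that] by simp
    have "(\<integral>x. functional_entropy (M i) (\<lambda>y. f (x(i := y))) \<partial>PiM (insert i J) M)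
      = (\<integral>x. (\<integral>y'. functional_entropy (M i) (\<lambda>y. f (x(i := y', i := y))) \<partial>M i) \<partial>PiM J M)"
      using insert.hyps insert.prems updi l
      by (intro integral_bounded_insert[where B = B])
        (auto simp: B_def intro!: M.functional_entropy_abs_le)
    thus ?thesis by (simp add: M.prob_space)
  qed
  show ?case unfolding sum.insert[OF insert.hyps] using 3 4 5 by linarith
qed

section \<open>Herbst's argument\<close>

lemma (in sigma_finite_measure) borel_measurable_soft_min[measurable (raw)]:
  assumes [measurable]: "case_prod f \<in> borel_measurable (N \<Otimes>\<^sub>M M)"
  shows "(\<lambda>x. soft_min M (f x)) \<in> borel_measurable N"
  unfolding soft_min_def by measurable

text \<open>Since \<open>Z\<close> is bounded, a second-order Taylor estimate holds uniformly under
  the integral: the difference quotient misses the candidate by at most a constant times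
  \<open>|h|\<close>.\<close>

lemma (in prob_space) DERIV_mgf:
  fixes Z :: "'a \<Rightarrow> real"
  assumes [measurable]: "Z \<in> borel_measurable M" and C: "\<And>x. x \<in> space M \<Longrightarrow> \<bar>Z x\<bar> \<le> C"
  shows "((\<lambda>t. \<integral>x. exp (t * Z x) \<partial>M) has_real_derivative (\<integral>x. Z x * exp (t * Z x) \<partial>M)) (at t)"
proof -
  have C0: "0 \<le> C" using C not_empty by (meson abs_ge_zero ex_in_conv order_trans)
  have expC: "exp (s * Z x) \<le> exp (\<bar>s\<bar> * C)" if "x \<in> space M" for s x
  proof -
    have "s * Z x \<le> \<bar>s\<bar> * \<bar>Z x\<bar>" by (metis abs_ge_self abs_mult)
    also have "\<dots> \<le> \<bar>s\<bar> * C" using C[OF that] by (intro mult_left_mono) auto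
    finally show ?thesis by simp
  qed
  have int: "integrable M (\<lambda>x. exp (s * Z x))" for s
    using expC by (intro integrable_bounded[where B = "exp (\<bar>s\<bar> * C)"]) auto
  have bZ: "\<bar>Z x * exp (s * Z x)\<bar> \<le> C * exp (\<bar>s\<bar> * C)" if "x \<in> space M" for s x
    unfolding abs_mult using C[OF that] expC[OF that, of s] C0 by (intro mult_mono) auto
  have int': "integrable M (\<lambda>x. Z x * exp (s * Z x))" for s
    using bZ by (intro integrable_bounded) auto
  define K where "K = exp (\<bar>t\<bar> * C) * (C\<^sup>2 * exp C)"
  let ?F = "\<lambda>t. \<integral>x. exp (t * Z x) \<partial>M" and ?D = "\<integral>x. Z x * exp (t * Z x) \<partial>M"
  have taylor: "\<bar>exp u - 1 - u\<bar> \<le> u\<^sup>2 * exp \<bar>u\<bar>" for u :: real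
  proof -
    obtain s where s: "\<bar>s\<bar> \<le> \<bar>u\<bar>" "exp u = (\<Sum>m<2. u ^ m / fact m) + exp s / fact 2 * u ^ 2"
      using Maclaurin_exp_le[of u 2] by blast
    hence "\<bar>exp u - 1 - u\<bar> = exp s / 2 * u\<^sup>2" by (simp add: eval_nat_numeral)
    also have "\<dots> \<le> exp \<bar>u\<bar> * u\<^sup>2"
    proof (rule mult_right_mono)
      have "exp s \<le> exp \<bar>u\<bar>" using s(1) by simp
      thus "exp s / 2 \<le> exp \<bar>u\<bar>" using exp_gt_zero[of s] by linarith
    qed simp
    finally show ?thesis by (simp add: mult.commute)
  qed
  have est: "\<bar>(?F (t + h) - ?F t) / h - ?D\<bar> \<le> K * \<bar>h\<bar>" if h: "h \<noteq> 0" "\<bar>h\<bar> \<le> 1" for h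
  proof -
    have "(?F (t + h) - ?F t) / h - ?D = (\<integral>x. (exp ((t + h) * Z x) - exp (t * Z x)) / h - Z x * exp (t * Z x) \<partial>M)"
      using int int' by simp
    also have "\<bar>\<dots>\<bar> \<le> K * \<bar>h\<bar>"
    proof (rule abs_integral_le)
      fix x assume x: "x \<in> space M"
      have "(exp ((t + h) * Z x) - exp (t * Z x)) / h - Z x * exp (t * Z x)
          = exp (t * Z x) * (exp (h * Z x) - 1 - h * Z x) / h"
        using h by (simp add: field_simps exp_add)
      also have "\<bar>\<dots>\<bar> \<le> exp (\<bar>t\<bar> * C) * ((h * Z x)\<^sup>2 * exp \<bar>h * Z x\<bar>) / \<bar>h\<bar>"
        unfolding abs_divide abs_mult[of "exp _"] abs_exp_cancel
        using taylor[of "h * Z x"] expC[OF x] by (intro divide_right_mono mult_mono) auto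
      also have "\<dots> = exp (\<bar>t\<bar> * C) * ((Z x)\<^sup>2 * exp \<bar>h * Z x\<bar>) * \<bar>h\<bar>"
        using h by (simp add: field_simps power2_eq_square)
      also have "\<dots> \<le> exp (\<bar>t\<bar> * C) * (C\<^sup>2 * exp C) * \<bar>h\<bar>"
      proof (intro mult_right_mono mult_left_mono mult_mono)
        show "(Z x)\<^sup>2 \<le> C\<^sup>2" using C[OF x] by (simp add: abs_le_square_iff[symmetric])
        have "\<bar>h\<bar> * \<bar>Z x\<bar> \<le> 1 * C" using C[OF x] h by (intro mult_mono) auto
        thus "exp \<bar>h * Z x\<bar> \<le> exp C" by (simp add: abs_mult)
      qed auto
      finally show "\<bar>(exp ((t + h) * Z x) - exp (t * Z x)) / h - Z x * exp (t * Z x)\<bar> \<le> K * \<bar>h\<bar>"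
        by (simp add: K_def)
    qed simp
    finally show ?thesis .
  qed
  have "((\<lambda>h. (?F (t + h) - ?F t) / h - ?D) \<longlongrightarrow> 0) (at 0)"
  proof (rule Lim_null_comparison)
    show "\<forall>\<^sub>F h in at 0. norm ((?F (t + h) - ?F t) / h - ?D) \<le> K * \<bar>h\<bar>"
      unfolding eventually_at using est by (intro exI[of _ 1]) (auto simp: dist_real_def)
    show "((\<lambda>h. K * \<bar>h\<bar>) \<longlongrightarrow> 0) (at 0)"
      by (auto intro!: tendsto_eq_intros)
  qed
  thus ?thesis unfolding DERIV_def by (rule LIM_zero_cancel)
qed

text \<open>
  Herbst's argument: with \<open>L t = ln (\<integral>x. exp (t * Z x) \<partial>M)\<close> the hypothesis reads
  \<open>t (3 + t) L' t \<le> (3 + 6 t) L t\<close>, so that \<open>L t / (t (3 + t)^5)\<close> is nonincreasing.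
\<close>

lemma (in prob_space) ln_mgf_le:
  fixes Z :: "'a \<Rightarrow> real"
  assumes [measurable]: "Z \<in> borel_measurable M" and C: "\<And>x. x \<in> space M \<Longrightarrow> \<bar>Z x\<bar> \<le> C"
    and ent: "\<And>t. 0 < t \<Longrightarrow> t \<le> 2 \<Longrightarrow>
      functional_entropy M (\<lambda>x. exp (t * Z x)) \<le> 5 * t\<^sup>2 / (3 + 6*t) * (\<integral>x. Z x * exp (t * Z x) \<partial>M)"
    and t: "0 < t" "t \<le> 2"
  shows "ln (\<integral>x. exp (t * Z x) \<partial>M) \<le> t * (\<integral>x. Z x \<partial>M) * (1 + t / 3) ^ 5"
proof -
  define F F' where "F s = (\<integral>x. exp (s * Z x) \<partial>M)" and "F' s = (\<integral>x. Z x * exp (s * Z x) \<partial>M)" for s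
  define L where "L s = ln (F s)" for s
  \<comment> \<open>From \<open>(3 + 6 s) / (s (3 + s)) = 1 / s + 5 / (3 + s)\<close> the extremal
    solution is a multiple of \<open>s * (3 + s)^5\<close>; the divisor \<open>243 = 3^5\<close>
    makes \<open>D s / s\<close> tend to \<open>1\<close> at \<open>0\<close>.\<close>
  define D where "D s = s * (3 + s) ^ 5 / 243" for s :: real
  have Fpos: "0 < F s" for s
  proof -
    have "exp (- (\<bar>s\<bar> * C)) \<le> exp (s * Z x) \<and> exp (s * Z x) \<le> exp (\<bar>s\<bar> * C)" if "x \<in> space M" for x
    proof -
      have "\<bar>s * Z x\<bar> \<le> \<bar>s\<bar> * C" using C[OF that] unfolding abs_mult by (intro mult_left_mono) auto
      thus ?thesis by (simp add: abs_le_iff)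
    qed
    hence "exp (- (\<bar>s\<bar> * C)) \<le> F s"
      unfolding F_def by (intro integral_between[where u = "exp (\<bar>s\<bar> * C)"]) auto
    thus ?thesis using exp_gt_zero less_le_trans by blast
  qed
  have dF: "(F has_real_derivative F' s) (at s)" for s
    unfolding F_def F'_def using C by (intro DERIV_mgf) auto
  have dL: "(L has_real_derivative F' s / F s) (at s)" for s
    unfolding L_def using Fpos[of s] by (auto intro!: derivative_eq_intros dF)
  have dD: "(D has_real_derivative (3 + s) ^ 4 * (3 + 6 * s) / 243) (at s)" for s
    unfolding D_def by (auto intro!: derivative_eq_intros simp: eval_nat_numeral field_simps)
  have Dpos: "D s > 0" if "s > 0" for s using that by (simp add: D_def)
  have key: "s * (3 + s) * (F' s / F s) \<le> (3 + 6 * s) * L s" if s: "0 < s" "s \<le> 2" for s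
  proof -
    have "(\<integral>x. exp (s * Z x) * ln (exp (s * Z x)) \<partial>M) = s * F' s"
      unfolding F'_def by (simp add: mult_ac flip: integral_mult_right_zero)
    hence "s * F' s - F s * L s \<le> 5 * s\<^sup>2 / (3 + 6 * s) * F' s"
      using ent[OF s] by (simp add: functional_entropy_def F_def[symmetric] F'_def[symmetric] L_def)
    hence "s * (3 + s) * F' s \<le> (3 + 6 * s) * (F s * L s)"
      using s by (simp add: field_simps power2_eq_square)
    thus ?thesis using Fpos[of s] by (simp add: field_simps)
  qed
  have mono: "L t / D t \<le> L s / D s" if s: "0 < s" "s \<le> t" for s
  proof (rule DERIV_nonpos_imp_nonincreasing[OF s(2), where f = "\<lambda>s. L s / D s"])
    fix v assume v: "s \<le> v" "v \<le> t"
    let ?d = "(F' v / F v * D v - L v * ((3 + v) ^ 4 * (3 + 6 * v) / 243)) / (D v * D v)"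
    have "((\<lambda>s. L s / D s) has_real_derivative ?d) (at v)"
      using Dpos[of v] v s by (intro DERIV_divide dL dD) auto
    moreover have "?d \<le> 0"
    proof -
      have "F' v / F v * D v - L v * ((3 + v) ^ 4 * (3 + 6 * v) / 243)
          = (3 + v) ^ 4 / 243 * (v * (3 + v) * (F' v / F v) - (3 + 6 * v) * L v)"
      proof -
        have "q * (v * (p * (3 + v)) / 243) - l * (p * (3 + 6 * v) / 243)
            = p / 243 * (v * (3 + v) * q - (3 + 6 * v) * l)" for q p l :: real
          by (simp add: field_simps)
        moreover have "D v = v * ((3 + v) ^ 4 * (3 + v)) / 243"
          by (simp add: D_def eval_nat_numeral mult_ac)
        ultimately show ?thesis by metis
      qed
      also have "\<dots> \<le> 0"
        using key[of v] v s t by (intro mult_nonneg_nonpos) auto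
      finally show ?thesis by (intro divide_nonpos_nonneg) auto
    qed
    ultimately show "\<exists>y. ((\<lambda>s. L s / D s) has_real_derivative y) (at v) \<and> y \<le> 0" by blast
  qed
  have F0: "F 0 = 1" "F' 0 = integral\<^sup>L M Z" by (simp_all add: F_def F'_def prob_space)
  \<comment> \<open>The initial value is the derivative of \<open>L\<close> at \<open>0\<close>,
    that is, the mean of \<open>Z\<close>. Monotonicity compares \<open>t\<close> with every smaller
    \<open>s > 0\<close>, and \<open>s\<close> then tends to \<open>0\<close>.\<close>
  have "((\<lambda>s. L s / s) \<longlongrightarrow> integral\<^sup>L M Z) (at 0)"
    using dL[of 0] by (simp add: DERIV_def F0 L_def)
  hence "((\<lambda>s. L s / s) \<longlongrightarrow> integral\<^sup>L M Z) (at_right 0)"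
    by (rule tendsto_within_subset) auto
  hence "((\<lambda>s. L s / s / ((3 + s) ^ 5 / 243)) \<longlongrightarrow> integral\<^sup>L M Z / ((3 + 0) ^ 5 / 243)) (at_right 0)"
    by (intro tendsto_intros) auto
  moreover have "\<forall>\<^sub>F s in at_right 0. L t / D t \<le> L s / s / ((3 + s) ^ 5 / 243)"
    using eventually_at_right_less[of 0] eventually_at_right_field[of _ "0::real", THEN iffD2, of "\<lambda>s. s < t"] t
    by (auto simp: eventually_at_right_field D_def intro!: exI[of _ t] dest: mono)
  ultimately have "L t / D t \<le> integral\<^sup>L M Z / ((3 + 0) ^ 5 / 243)"
    by (intro tendsto_lowerbound) auto
  hence "L t \<le> integral\<^sup>L M Z * D t" using Dpos[OF t(1)] by (simp add: field_simps)
  also have "D t = t * (1 + t / 3) ^ 5"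
    by (simp add: D_def eval_nat_numeral field_simps)
  finally show ?thesis by (simp add: L_def F_def mult_ac)
qed

text \<open>The weight \<open>exp (t * Z x)\<close> is positive, so the pointwise self-bounding
  condition passes under the integral. It replaces the sum of increments, which tensorization and
  the one-coordinate entropy bound produce, by \<open>Z\<close> itself, as Herbst's argument
  requires.\<close>

lemma (in product_prob_space) ln_mgf_le_self_bounding:
  fixes Z :: "('i \<Rightarrow> 'a) \<Rightarrow> real"
  assumes J: "finite J" and [measurable]: "Z \<in> borel_measurable (PiM J M)"
    and C: "\<And>x. x \<in> space (PiM J M) \<Longrightarrow> \<bar>Z x\<bar> \<le> C"
    and osc: "\<And>x i y y'. x \<in> space (PiM J M) \<Longrightarrow> i \<in> J \<Longrightarrow> y \<in> space (M i) \<Longrightarrow> y' \<in> space (M i) \<Longrightarrow>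
      Z (x(i := y)) - Z (x(i := y')) \<le> 1"
    and self: "\<And>x. x \<in> space (PiM J M) \<Longrightarrow> (\<Sum>i\<in>J. Z x - soft_min (M i) (\<lambda>y. Z (x(i := y)))) \<le> Z x"
    and t: "0 < t" "t \<le> 2"
  shows "ln (\<integral>x. exp (t * Z x) \<partial>PiM J M) \<le> t * (\<integral>x. Z x \<partial>PiM J M) * (1 + t / 3) ^ 5"
proof -
  interpret PJ: prob_space "PiM J M" by (rule prob_space_PiM) (rule prob_space)
  have upd: "x(i := y) \<in> space (PiM J M)" if "x \<in> space (PiM J M)" "i \<in> J" "y \<in> space (M i)" for x i y
    using fun_upd_space_PiM[OF that(1,3)] that(2) by (simp add: insert_absorb)
  have ent: "functional_entropy (PiM J M) (\<lambda>x. exp (t * Z x))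
      \<le> 5 * t\<^sup>2 / (3 + 6*t) * (\<integral>x. Z x * exp (t * Z x) \<partial>PiM J M)" if t: "0 < t" "t \<le> 2" for t
  proof -
    define A where "A = 5 * t\<^sup>2 / (3 + 6*t)"
    have A: "A \<ge> 0" using t by (simp add: A_def)
    define s where "s i x = soft_min (M i) (\<lambda>y. Z (x(i := y)))" for i x
    \<comment> \<open>The soft minimum is constant along the section in coordinate \<open>i\<close>.
      The one-coordinate bound may therefore be read as an integral of a function of
      \<open>x(i := y)\<close>, and resampling removes the inner integral.\<close>
    have s_upd: "s i (x(i := y)) = s i x" for i x y by (simp add: s_def)
    have [measurable]: "(\<lambda>(x, y). x(i := y)) \<in> PiM J M \<Otimes>\<^sub>M M i \<rightarrow>\<^sub>M PiM J M" if "i \<in> J" for i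
      using that by (rule measurable_fun_upd_PiM)
    have msec[measurable]: "(\<lambda>y. Z (x(i := y))) \<in> borel_measurable (M i)"
      if "i \<in> J" "x \<in> space (PiM J M)" for i x
    proof -
      have "(\<lambda>y. x(i := y)) \<in> M i \<rightarrow>\<^sub>M PiM J M"
        using measurable_Pair2[OF measurable_fun_upd_PiM[OF that(1)] that(2)] by simp
      thus ?thesis by (rule measurable_compose) fact
    qed
    have ms[measurable]: "s i \<in> borel_measurable (PiM J M)" if [simp]: "i \<in> J" for i
      unfolding s_def by measurable
    have expb: "exp (- (t * C)) \<le> exp (t * Z x)" "exp (t * Z x) \<le> exp (t * C)" if "x \<in> space (PiM J M)" for x
    proof -
      have "\<bar>t * Z x\<bar> \<le> t * C" using C[OF that] t unfolding abs_mult by (intro mult_mono) auto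
      thus "exp (- (t * C)) \<le> exp (t * Z x)" "exp (t * Z x) \<le> exp (t * C)" by (auto simp: abs_le_iff)
    qed
    have sb: "\<bar>s i x\<bar> \<le> C" if "i \<in> J" "x \<in> space (PiM J M)" for i x
    proof -
      have "- C \<le> Z (x(i := y))" "Z (x(i := y)) \<le> C" if "y \<in> space (M i)" for y
        using C[OF upd[OF \<open>x \<in> _\<close> \<open>i \<in> J\<close> that]] by auto
      hence "- C \<le> s i x" "s i x \<le> C"
        using that unfolding s_def by (auto intro!: M.soft_min_bounds)
      thus ?thesis by simp
    qed
    have b: "\<bar>exp (t * Z x) * (Z x - s i x)\<bar> \<le> exp (t * C) * (C + C)" if "i \<in> J" "x \<in> space (PiM J M)" for i x
      unfolding abs_mult using expb[OF that(2)] C[OF that(2)] sb[OF that] by (intro mult_mono) auto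
    have b': "\<bar>Z x * exp (t * Z x)\<bar> \<le> C * exp (t * C)" if "x \<in> space (PiM J M)" for x
      unfolding abs_mult using expb[OF that] C[OF that] by (intro mult_mono) auto
    have "functional_entropy (PiM J M) (\<lambda>x. exp (t * Z x))
        \<le> (\<Sum>i\<in>J. \<integral>x. functional_entropy (M i) (\<lambda>y. exp (t * Z (x(i := y)))) \<partial>PiM J M)"
      using expb by (intro functional_entropy_tensorization J) auto
    also have "\<dots> \<le> (\<Sum>i\<in>J. A * (\<integral>x. exp (t * Z x) * (Z x - s i x) \<partial>PiM J M))"
    proof (rule sum_mono)
      fix i assume i[simp]: "i \<in> J"
      have "(\<integral>x. functional_entropy (M i) (\<lambda>y. exp (t * Z (x(i := y)))) \<partial>PiM J M)
          \<le> (\<integral>x. A * (\<integral>y. exp (t * Z (x(i := y))) * (Z (x(i := y)) - s i (x(i := y))) \<partial>M i) \<partial>PiM J M)"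
      proof (rule integral_mono)
        show "integrable (PiM J M) (\<lambda>x. functional_entropy (M i) (\<lambda>y. exp (t * Z (x(i := y)))))"
          using upd expb
          by (intro PJ.integrable_bounded[where B = "2 * (exp (t * C) * (\<bar>ln (exp (- (t * C)))\<bar> + \<bar>ln (exp (t * C))\<bar>))"]
                M.functional_entropy_abs_le) auto
        have "integrable (PiM J M) (\<lambda>x. \<integral>y. exp (t * Z (x(i := y))) * (Z (x(i := y)) - s i (x(i := y))) \<partial>M i)"
          using upd b[OF i]
          by (intro PJ.integrable_bounded[where B = "exp (t * C) * (C + C)"] M.abs_integral_le) auto
        thus "integrable (PiM J M) (\<lambda>x. A * (\<integral>y. exp (t * Z (x(i := y))) * (Z (x(i := y)) - s i (x(i := y))) \<partial>M i))"
          by simp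
        fix x assume x: "x \<in> space (PiM J M)"
        show "functional_entropy (M i) (\<lambda>y. exp (t * Z (x(i := y))))
            \<le> A * (\<integral>y. exp (t * Z (x(i := y))) * (Z (x(i := y)) - s i (x(i := y))) \<partial>M i)"
          unfolding s_upd unfolding s_def A_def
          using osc[OF x i] x by (intro M.functional_entropy_exp_le t) auto
      qed
      also have "\<dots> = A * (\<integral>x. exp (t * Z x) * (Z x - s i x) \<partial>PiM J M)"
        using integral_resample[OF J i _ b[OF i]] by simp
      finally show "(\<integral>x. functional_entropy (M i) (\<lambda>y. exp (t * Z (x(i := y)))) \<partial>PiM J M)
          \<le> A * (\<integral>x. exp (t * Z x) * (Z x - s i x) \<partial>PiM J M)" .
    qed
    also have "\<dots> = A * (\<integral>x. (\<Sum>i\<in>J. exp (t * Z x) * (Z x - s i x)) \<partial>PiM J M)"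
      using b by (subst Bochner_Integration.integral_sum)
        (auto intro!: PJ.integrable_bounded simp: sum_distrib_left)
    also have "\<dots> \<le> A * (\<integral>x. Z x * exp (t * Z x) \<partial>PiM J M)"
    proof (intro mult_left_mono integral_mono A)
      show "integrable (PiM J M) (\<lambda>x. \<Sum>i\<in>J. exp (t * Z x) * (Z x - s i x))"
        using b by (intro Bochner_Integration.integrable_sum PJ.integrable_bounded) auto
      show "integrable (PiM J M) (\<lambda>x. Z x * exp (t * Z x))"
        using b' by (intro PJ.integrable_bounded) auto
      fix x assume x: "x \<in> space (PiM J M)"
      have "exp (t * Z x) * (\<Sum>i\<in>J. Z x - s i x) \<le> exp (t * Z x) * Z x"
        using self[OF x] by (intro mult_left_mono) (auto simp: s_def)
      thus "(\<Sum>i\<in>J. exp (t * Z x) * (Z x - s i x)) \<le> Z x * exp (t * Z x)"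
        by (simp add: sum_distrib_left mult.commute)
    qed
    finally show ?thesis by (simp add: A_def)
  qed
  show ?thesis
    using C ent t by (intro PJ.ln_mgf_le) auto
qed

section \<open>Suprema of empirical processes\<close>

text \<open>After the quadratic bound on \<open>exp\<close> the linear term vanishes because
  \<open>g\<close> is centered, and \<open>1 + u \<le> exp u\<close> leads back to an exponent. The
  multiple of the variance is \<open>27/40 * (16/25)\<close> divided by \<open>4/5\<close>.\<close>

lemma (in prob_space) soft_min_ge:
  fixes Z g :: "'a \<Rightarrow> real"
  assumes [measurable]: "Z \<in> borel_measurable M" "g \<in> borel_measurable M"
    and C: "\<And>y. y \<in> space M \<Longrightarrow> \<bar>Z y\<bar> \<le> C"
    and g: "\<And>y. y \<in> space M \<Longrightarrow> \<bar>g y\<bar> \<le> 1" "(\<integral>y. g y \<partial>M) = 0"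
    and Zg: "\<And>y. y \<in> space M \<Longrightarrow> c + g y \<le> Z y"
  shows "c - 27/50 * (\<integral>y. (g y)\<^sup>2 \<partial>M) \<le> soft_min M Z"
proof -
  let ?v = "\<integral>y. (g y)\<^sup>2 \<partial>M"
  have sq: "\<bar>(g y)\<^sup>2\<bar> \<le> 1" if "y \<in> space M" for y
    using g(1)[OF that] by (simp add: abs_square_le_1)
  have int: "integrable M g" "integrable M (\<lambda>y. (g y)\<^sup>2)"
    using g(1) sq by (auto intro!: integrable_bounded[where B = 1])
  have bd: "- C \<le> Z y" "Z y \<le> C" if "y \<in> space M" for y using C[OF that] by auto
  have intZ: "integrable M (\<lambda>y. exp (-(4/5) * Z y))"
  proof (rule integrable_bounded[where B = "exp (4/5 * C)"])
    show "\<bar>exp (-(4/5) * Z y)\<bar> \<le> exp (4/5 * C)" if "y \<in> space M" for y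
      using bd(1)[OF that] by simp
  qed simp
  have "exp (-(4/5) * soft_min M Z) = (\<integral>y. exp (-(4/5) * Z y) \<partial>M)"
    using bd by (intro soft_min_bounds(3)) auto
  also have "\<dots> \<le> (\<integral>y. exp (-(4/5) * c) * (1 + (-(4/5)) * g y + 27/40 * (16/25) * (g y)\<^sup>2) \<partial>M)"
  proof (intro integral_mono intZ)
    fix y assume y: "y \<in> space M"
    have "exp (-(4/5) * Z y) \<le> exp (-(4/5) * c) * exp (-(4/5) * g y)"
      using Zg[OF y] by (simp flip: exp_add)
    also have "\<dots> \<le> exp (-(4/5) * c) * (1 + (-(4/5)) * g y + 27/40 * (-(4/5) * g y)\<^sup>2)"
      using g(1)[OF y] by (intro mult_left_mono exp_le_quadratic) (auto simp: abs_mult)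
    finally show "exp (-(4/5) * Z y) \<le> exp (-(4/5) * c) * (1 + (-(4/5)) * g y + 27/40 * (16/25) * (g y)\<^sup>2)"
      by (simp add: power2_eq_square)
  qed (use int in auto)
  also have "\<dots> = exp (-(4/5) * c) * (1 + 27/40 * (16/25) * ?v)"
    using int g(2) by (simp add: prob_space)
  also have "\<dots> \<le> exp (-(4/5) * c) * exp (27/40 * (16/25) * ?v)"
    by (intro mult_left_mono exp_ge_add_one_self) auto
  finally show ?thesis by (simp flip: exp_add)
qed

text \<open>Increments over the soft minimum are unchanged by a shift, so a remainder in the
  self-bounding inequality can be moved into the function.\<close>

lemma (in prob_space) soft_min_add:
  fixes Z :: "'a \<Rightarrow> real"
  assumes [measurable]: "Z \<in> borel_measurable M" and C: "\<And>y. y \<in> space M \<Longrightarrow> \<bar>Z y\<bar> \<le> C"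
  shows "soft_min M (\<lambda>y. Z y + a) = soft_min M Z + a"
proof -
  have bd: "- C \<le> Z y" "Z y \<le> C" if "y \<in> space M" for y using C[OF that] by auto
  have e: "exp (-(4/5) * soft_min M Z) = (\<integral>y. exp (-(4/5) * Z y) \<partial>M)"
    using bd by (intro soft_min_bounds(3)) auto
  have exp_split: "exp (-(4/5) * (z + a)) = exp (-(4/5) * a) * exp (-(4/5) * z)" for z
    by (subst exp_add[symmetric]) (simp add: field_simps)
  have "(\<integral>y. exp (-(4/5) * (Z y + a)) \<partial>M) = exp (-(4/5) * a) * (\<integral>y. exp (-(4/5) * Z y) \<partial>M)"
    unfolding exp_split by (rule integral_mult_right_zero)
  also have "\<dots> = exp (-(4/5) * (soft_min M Z + a))"
    unfolding e[symmetric] exp_split ..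
  finally show ?thesis by (simp add: soft_min_def[of M "\<lambda>y. Z y + a"])
qed

text \<open>The mean \<open>0\<close> lies between the infimum and the supremum of \<open>g\<close>,
  so the oscillation alone controls the size.\<close>

lemma (in prob_space) centered_abs_le:
  fixes g :: "'a \<Rightarrow> real"
  assumes [measurable]: "g \<in> borel_measurable M" and g: "(\<integral>y. g y \<partial>M) = 0"
    and osc: "\<And>y y'. y \<in> space M \<Longrightarrow> y' \<in> space M \<Longrightarrow> g y - g y' \<le> c" and y: "y \<in> space M"
  shows "\<bar>g y\<bar> \<le> c"
proof -
  have "g y - c \<le> g y'" "g y' \<le> g y + c" if "y' \<in> space M" for y'
    using osc[OF y that] osc[OF that y] by auto
  hence "g y - c \<le> (\<integral>y. g y \<partial>M)" "(\<integral>y. g y \<partial>M) \<le> g y + c"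
    using integral_between[of g "g y - c" "g y + c"] by auto
  thus ?thesis using g by auto
qed

text \<open>A single member of the class has mean zero and \<open>Z\<close> dominates it. The sign
  keeps \<open>V + 2 E\<close> nonnegative under the square root.\<close>

lemma (in product_prob_space) sup_expectation_nonneg:
  fixes G :: "('i \<Rightarrow> 'a \<Rightarrow> real) set" and Z :: "('i \<Rightarrow> 'a) \<Rightarrow> real"
  assumes J: "finite J" and g: "g \<in> G"
    and meas: "\<And>i. i \<in> J \<Longrightarrow> g i \<in> borel_measurable (M i)"
    and mean: "\<And>i. i \<in> J \<Longrightarrow> (\<integral>y. g i y \<partial>M i) = 0"
    and b: "\<And>i y. i \<in> J \<Longrightarrow> y \<in> space (M i) \<Longrightarrow> \<bar>g i y\<bar> \<le> c"
    and Z: "integrable (PiM J M) Z"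
    and le: "\<And>x. x \<in> space (PiM J M) \<Longrightarrow> (\<Sum>i\<in>J. g i (x i)) \<le> Z x"
  shows "0 \<le> (\<integral>x. Z x \<partial>PiM J M)"
proof -
  interpret PJ: prob_space "PiM J M" by (rule prob_space_PiM) (rule prob_space)
  have m[measurable]: "(\<lambda>x. g i (x i)) \<in> borel_measurable (PiM J M)" if "i \<in> J" for i
    by (rule measurable_compose[OF measurable_component_singleton[OF that]]) (rule meas[OF that])
  have bb: "\<bar>g i (x i)\<bar> \<le> c" if "i \<in> J" "x \<in> space (PiM J M)" for i x
    using that by (intro b) (auto simp: space_PiM PiE_def Pi_def)
  have int: "integrable (PiM J M) (\<lambda>x. g i (x i))" if "i \<in> J" for i
    using that bb by (intro PJ.integrable_bounded[where B = c]) auto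
  have "(\<integral>x. g i (x i) \<partial>PiM J M) = 0" if "i \<in> J" for i
    using integral_resample[where f = "\<lambda>x. g i (x i)" and B = c, OF J that m[OF that]] bb that mean by simp
  hence "0 = (\<integral>x. (\<Sum>i\<in>J. g i (x i)) \<partial>PiM J M)"
    using int by (simp add: Bochner_Integration.integral_sum)
  also have "\<dots> \<le> (\<integral>x. Z x \<partial>PiM J M)"
    using int le Z by (intro integral_mono Bochner_Integration.integrable_sum) auto
  finally show ?thesis .
qed

text \<open>
  Below, \<open>Z x\<close> is the supremum of \<open>\<Sum>i\<in>J. g i (x i)\<close> over \<open>g \<in> G\<close>, expressed by
  its universal property. Replacing coordinate \<open>i\<close> by its soft minimum loses at most
  \<open>g i (x i) + 27/50 Var (g i)\<close> for every nearly maximizing \<open>g\<close>; summed over \<open>i\<close> this makes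
  \<open>Z + 27/50 V\<close> self-bounding, with the supremum of the summed variances rather than the sum of
  the suprema.
\<close>

lemma (in product_prob_space) sup_ln_mgf_le:
  fixes G :: "('i \<Rightarrow> 'a \<Rightarrow> real) set" and Z :: "('i \<Rightarrow> 'a) \<Rightarrow> real"
  assumes J: "finite J" "J \<noteq> {}" and G: "G \<noteq> {}"
    and meas: "\<And>g i. g \<in> G \<Longrightarrow> i \<in> J \<Longrightarrow> g i \<in> borel_measurable (M i)"
    and mean: "\<And>g i. g \<in> G \<Longrightarrow> i \<in> J \<Longrightarrow> (\<integral>y. g i y \<partial>M i) = 0"
    and osc: "\<And>g i y y'. g \<in> G \<Longrightarrow> i \<in> J \<Longrightarrow> y \<in> space (M i) \<Longrightarrow> y' \<in> space (M i) \<Longrightarrow> g i y - g i y' \<le> 1"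
    and var: "\<And>g. g \<in> G \<Longrightarrow> (\<Sum>i\<in>J. \<integral>y. (g i y)\<^sup>2 \<partial>M i) \<le> V"
    and Z[measurable]: "Z \<in> borel_measurable (PiM J M)"
    and lub: "\<And>x c. x \<in> space (PiM J M) \<Longrightarrow> Z x \<le> c \<longleftrightarrow> (\<forall>g\<in>G. (\<Sum>i\<in>J. g i (x i)) \<le> c)"
    and t: "0 < t" "t \<le> 2"
  shows "ln (\<integral>x. exp (t * Z x) \<partial>PiM J M) + t * (27/50 * V)
    \<le> t * ((\<integral>x. Z x \<partial>PiM J M) + 27/50 * V) * (1 + t / 3) ^ 5"
    and "\<And>x. x \<in> space (PiM J M) \<Longrightarrow> \<bar>Z x\<bar> \<le> card J"
    and "0 \<le> (\<integral>x. Z x \<partial>PiM J M)"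
proof -
  interpret PJ: prob_space "PiM J M" by (rule prob_space_PiM) (rule prob_space)
  define a where "a = 27/50 * V"
  have xi: "x i \<in> space (M i)" if "x \<in> space (PiM J M)" "i \<in> J" for x i
    using that by (auto simp: space_PiM PiE_def Pi_def)
  have upd: "x(i := y) \<in> space (PiM J M)" if "x \<in> space (PiM J M)" "i \<in> J" "y \<in> space (M i)" for x i y
    using fun_upd_space_PiM[OF that(1,3)] that(2) by (simp add: insert_absorb)
  have g1: "\<bar>g i y\<bar> \<le> 1" if "g \<in> G" "i \<in> J" "y \<in> space (M i)" for g i y
    using M.centered_abs_le[OF meas[OF that(1,2)] mean[OF that(1,2)] osc[OF that(1,2)] that(3)] .
  have S_abs: "\<bar>\<Sum>i\<in>J. g i (x i)\<bar> \<le> card J" if "g \<in> G" "x \<in> space (PiM J M)" for g x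
  proof -
    have "\<bar>\<Sum>i\<in>J. g i (x i)\<bar> \<le> (\<Sum>i\<in>J. \<bar>g i (x i)\<bar>)" by (rule sum_abs)
    also have "\<dots> \<le> (\<Sum>i\<in>J. 1)" using that g1 xi by (intro sum_mono) auto
    finally show ?thesis by simp
  qed
  have S_le: "(\<Sum>i\<in>J. g i (x i)) \<le> Z x" if "g \<in> G" "x \<in> space (PiM J M)" for g x
    using lub[OF that(2), of "Z x"] that(1) by simp
  have C: "\<bar>Z x\<bar> \<le> card J" if x: "x \<in> space (PiM J M)" for x
  proof -
    obtain g where g: "g \<in> G" using G by auto
    have "Z x \<le> card J" using S_abs[OF _ x] by (subst lub[OF x]) (force simp: abs_le_iff)
    moreover have "- real (card J) \<le> Z x" using S_le[OF g x] S_abs[OF g x] by linarith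
    ultimately show ?thesis by simp
  qed
  show "\<And>x. x \<in> space (PiM J M) \<Longrightarrow> \<bar>Z x\<bar> \<le> card J" by (rule C)
  have intZ: "integrable (PiM J M) Z" using C by (intro PJ.integrable_bounded) auto
  obtain g0 where g0: "g0 \<in> G" using G by auto
  show "0 \<le> (\<integral>x. Z x \<partial>PiM J M)"
    using g0 meas mean g1 S_le by (intro sup_expectation_nonneg[OF J(1) g0 _ _ _ intZ, where c = 1]) auto
  have sum_upd: "(\<Sum>k\<in>J. g k ((x(i := y)) k)) = (\<Sum>k\<in>J. g k (x k)) - g i (x i) + g i y" if "i \<in> J" for g :: "'i \<Rightarrow> 'a \<Rightarrow> real" and x i y
    using J(1) that by (simp add: sum.remove[of J i])
  have Zosc: "Z (x(i := y)) - Z (x(i := y')) \<le> 1"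
    if x: "x \<in> space (PiM J M)" and i: "i \<in> J" and y: "y \<in> space (M i)" "y' \<in> space (M i)" for x i y y'
  proof -
    have "(\<Sum>k\<in>J. g k ((x(i := y)) k)) \<le> Z (x(i := y')) + 1" if g: "g \<in> G" for g
      using S_le[OF g upd[OF x i y(2)]] osc[OF g i y] unfolding sum_upd[OF i] by simp
    hence "Z (x(i := y)) \<le> Z (x(i := y')) + 1" using lub[OF upd[OF x i y(1)]] by blast
    thus ?thesis by simp
  qed
  define s where "s i x = soft_min (M i) (\<lambda>y. Z (x(i := y)))" for i x
  have msec: "(\<lambda>y. Z (x(i := y))) \<in> borel_measurable (M i)"
    if "i \<in> J" "x \<in> space (PiM J M)" for i x
  proof -
    have "(\<lambda>y. x(i := y)) \<in> M i \<rightarrow>\<^sub>M PiM J M"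
      using measurable_Pair2[OF measurable_fun_upd_PiM[OF that(1)] that(2)] by simp
    thus ?thesis by (rule measurable_compose) fact
  qed
  have self: "(\<Sum>i\<in>J. Z x - s i x) \<le> Z x + a" if x: "x \<in> space (PiM J M)" for x
  proof -
    \<comment> \<open>A maximizing \<open>g\<close> may fail to exist, so the bound is shown for
      every \<open>g\<close>. Summing over \<open>i\<close> produces the full sum
      \<open>card J\<close> times; dividing by \<open>card J\<close> isolates it, and the universal
      property of \<open>Z\<close> passes to the supremum.\<close>
    have "(\<Sum>i\<in>J. g i (x i)) \<le> (Z x + a + (\<Sum>i\<in>J. s i x)) / card J" if g: "g \<in> G" for g
    proof -
      let ?S = "\<Sum>i\<in>J. g i (x i)"
      have "?S - g i (x i) - 27/50 * (\<integral>y. (g i y)\<^sup>2 \<partial>M i) \<le> s i x" if i: "i \<in> J" for i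
        unfolding s_def
      proof (rule M.soft_min_ge[OF msec[OF i x] meas[OF g i]])
        show "\<bar>Z (x(i := y))\<bar> \<le> card J" if "y \<in> space (M i)" for y
          using upd[OF x i that] by (rule C)
        show "?S - g i (x i) + g i y \<le> Z (x(i := y))" if "y \<in> space (M i)" for y
          using S_le[OF g upd[OF x i that]] unfolding sum_upd[OF i] .
      qed (use g1[OF g i] mean[OF g i] in auto)
      hence "(\<Sum>i\<in>J. ?S - g i (x i) - 27/50 * (\<integral>y. (g i y)\<^sup>2 \<partial>M i)) \<le> (\<Sum>i\<in>J. s i x)"
        by (intro sum_mono) auto
      hence "card J * ?S \<le> ?S + 27/50 * (\<Sum>i\<in>J. \<integral>y. (g i y)\<^sup>2 \<partial>M i) + (\<Sum>i\<in>J. s i x)"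
        by (simp add: sum_subtractf sum_distrib_left)
      also have "\<dots> \<le> Z x + a + (\<Sum>i\<in>J. s i x)"
        using S_le[OF g x] var[OF g] by (simp add: a_def)
      finally show ?thesis using J by (simp add: field_simps card_gt_0_iff)
    qed
    hence "Z x \<le> (Z x + a + (\<Sum>i\<in>J. s i x)) / card J" using lub[OF x] by blast
    thus ?thesis using J by (simp add: field_simps card_gt_0_iff sum_subtractf)
  qed
  have "ln (\<integral>x. exp (t * (Z x + a)) \<partial>PiM J M) \<le> t * (\<integral>x. Z x + a \<partial>PiM J M) * (1 + t / 3) ^ 5"
  proof (rule ln_mgf_le_self_bounding[OF J(1) _ _ _ _ t])
    show "\<bar>Z x + a\<bar> \<le> card J + \<bar>a\<bar>" if "x \<in> space (PiM J M)" for x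
      using C[OF that] by linarith
    show "(\<Sum>i\<in>J. (Z x + a) - soft_min (M i) (\<lambda>y. Z (x(i := y)) + a)) \<le> Z x + a"
      if x: "x \<in> space (PiM J M)" for x
    proof -
      have "soft_min (M i) (\<lambda>y. Z (x(i := y)) + a) = s i x + a" if i: "i \<in> J" for i
        unfolding s_def using C upd[OF x i] by (intro M.soft_min_add msec[OF i x]) auto
      thus ?thesis using self[OF x] by simp
    qed
  qed (use Zosc in auto)
  also have "(\<integral>x. exp (t * (Z x + a)) \<partial>PiM J M) = exp (t * a) * (\<integral>x. exp (t * Z x) \<partial>PiM J M)"
    by (simp add: algebra_simps exp_add)
  also have "ln \<dots> = t * a + ln (\<integral>x. exp (t * Z x) \<partial>PiM J M)"
  proof -
    have "exp (- (t * card J)) \<le> exp (t * Z x) \<and> exp (t * Z x) \<le> exp (t * card J)"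
      if "x \<in> space (PiM J M)" for x
    proof -
      have "\<bar>t * Z x\<bar> \<le> t * card J" using C[OF that] t unfolding abs_mult by (intro mult_mono) auto
      thus ?thesis by (simp add: abs_le_iff)
    qed
    hence "exp (- (t * card J)) \<le> (\<integral>x. exp (t * Z x) \<partial>PiM J M)"
      by (intro PJ.integral_between[where u = "exp (t * card J)"]) auto
    hence "0 < (\<integral>x. exp (t * Z x) \<partial>PiM J M)" using exp_gt_zero less_le_trans by blast
    thus ?thesis by (simp add: ln_mult)
  qed
  also have "(\<integral>x. Z x + a \<partial>PiM J M) = (\<integral>x. Z x \<partial>PiM J M) + a"
    using intZ by (simp add: PJ.prob_space)
  finally show "ln (\<integral>x. exp (t * Z x) \<partial>PiM J M) + t * (27/50 * V)
    \<le> t * ((\<integral>x. Z x \<partial>PiM J M) + 27/50 * V) * (1 + t / 3) ^ 5"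
    by (simp add: a_def)
qed

section \<open>From the moment generating function to a tail bound\<close>

lemma mgf_factor_le:
  fixes t E V :: real
  assumes t: "0 < t" "t < 2" and EV: "0 \<le> E" "0 \<le> V"
  shows "t * (E + 27/50 * V) * (1 + t / 3) ^ 5 - t * (27/50 * V) \<le> t * E + 2 * t\<^sup>2 * (V + 2 * E) / (2 - t)"
proof -
  \<comment> \<open>Only \<open>p * (2 - t)\<close> has to be bounded, since the target is a
    sub-gamma bound with its pole at \<open>t = 2\<close>.\<close>
  define p where "p = 5/3 + 10/9 * t + 10/27 * t\<^sup>2 + 5/81 * t^3 + t^4 / 243"
  have p: "(1 + t / 3) ^ 5 = 1 + t * p"
    unfolding p_def by (simp add: field_simps eval_nat_numeral)
  have "p * (2 - t) = 10/3 + 5/9 * t - 10/27 * t\<^sup>2 - 20/81 * t^3 - 13/243 * t^4 - t^5 / 243"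
    unfolding p_def by (simp add: field_simps eval_nat_numeral)
  also have "\<dots> \<le> 10/3 + 5/9 * t - 10/27 * t\<^sup>2"
  proof -
    have "0 \<le> t^3" "0 \<le> t^4" "0 \<le> t^5" using t by auto
    thus ?thesis by argo
  qed
  \<comment> \<open>Up to the factor \<open>10/27\<close> this is
    \<open>t^2 - 3/2 t + 1 \<ge> 0\<close>, where the left side is smallest at
    \<open>t = 3/4\<close>.\<close>
  also have "\<dots> \<le> 100/27"
    using zero_le_power2[of "t - 3/4"] by (simp add: power2_eq_square algebra_simps)
  finally have p2: "p * (2 - t) \<le> 100/27" .
  have "t * (E + 27/50 * V) * (1 + t / 3) ^ 5 - t * (27/50 * V) = t * E + t\<^sup>2 / (2 - t) * (p * (2 - t) * (E + 27/50 * V))"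
    using t unfolding p by (simp add: field_simps power2_eq_square)
  also have "\<dots> \<le> t * E + t\<^sup>2 / (2 - t) * (2 * (V + 2 * E))"
  proof (intro add_left_mono mult_left_mono)
    have "p * (2 - t) * (E + 27/50 * V) \<le> 100/27 * (E + 27/50 * V)"
      using p2 EV by (intro mult_right_mono) auto
    also have "\<dots> \<le> 2 * (V + 2 * E)" using EV by simp
    finally show "p * (2 - t) * (E + 27/50 * V) \<le> 2 * (V + 2 * E)" .
  qed (use t in auto)
  also have "\<dots> = t * E + 2 * t\<^sup>2 * (V + 2 * E) / (2 - t)" by simp
  finally show ?thesis .
qed

lemma (in product_prob_space) sup_concentration_unit:
  fixes G :: "('i \<Rightarrow> 'a \<Rightarrow> real) set" and Z :: "('i \<Rightarrow> 'a) \<Rightarrow> real"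
  assumes J: "finite J" "J \<noteq> {}" and G: "G \<noteq> {}"
    and meas: "\<And>g i. g \<in> G \<Longrightarrow> i \<in> J \<Longrightarrow> g i \<in> borel_measurable (M i)"
    and mean: "\<And>g i. g \<in> G \<Longrightarrow> i \<in> J \<Longrightarrow> (\<integral>y. g i y \<partial>M i) = 0"
    and osc: "\<And>g i y y'. g \<in> G \<Longrightarrow> i \<in> J \<Longrightarrow> y \<in> space (M i) \<Longrightarrow> y' \<in> space (M i) \<Longrightarrow> g i y - g i y' \<le> 1"
    and var: "\<And>g. g \<in> G \<Longrightarrow> (\<Sum>i\<in>J. \<integral>y. (g i y)\<^sup>2 \<partial>M i) \<le> V"
    and Z[measurable]: "Z \<in> borel_measurable (PiM J M)"
    and lub: "\<And>x c. x \<in> space (PiM J M) \<Longrightarrow> Z x \<le> c \<longleftrightarrow> (\<forall>g\<in>G. (\<Sum>i\<in>J. g i (x i)) \<le> c)"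
    and x: "0 < x"
  defines "E \<equiv> \<integral>z. Z z \<partial>PiM J M"
  shows "measure (PiM J M) {z \<in> space (PiM J M). E + 2 * sqrt (x * (V + 2 * E)) + x / 2 \<le> Z z} \<le> exp (- x)"
proof -
  interpret PJ: prob_space "PiM J M" by (rule prob_space_PiM) (rule prob_space)
  have mgf: "ln (\<integral>z. exp (t * Z z) \<partial>PiM J M) + t * (27/50 * V) \<le> t * (E + 27/50 * V) * (1 + t / 3) ^ 5"
    if "0 < t" "t \<le> 2" for t
    unfolding E_def by (rule sup_ln_mgf_le(1)[OF J G]) (fact meas mean osc var Z lub that)+
  have C: "\<bar>Z z\<bar> \<le> card J" if "z \<in> space (PiM J M)" for z
    by (rule sup_ln_mgf_le(2)[OF J G _ _ _ _ _ _ zero_less_one]) (fact meas mean osc var Z lub that | simp)+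
  have E: "0 \<le> E"
    unfolding E_def
    by (rule sup_ln_mgf_le(3)[OF J G _ _ _ _ _ _ zero_less_one]) (fact meas mean osc var Z lub | simp)+
  obtain g where g: "g \<in> G" using G by auto
  have "0 \<le> (\<Sum>i\<in>J. \<integral>y. (g i y)\<^sup>2 \<partial>M i)" by (intro sum_nonneg integral_nonneg) auto
  hence V: "0 \<le> V" using var[OF g] by simp
  define v where "v = V + 2 * E"
  define a where "a = E + 2 * sqrt (x * v) + x / 2"
  define F where "F t = (\<integral>z. exp (t * Z z) \<partial>PiM J M)" for t
  have expb: "exp (- (t * card J)) \<le> exp (t * Z z)" "exp (t * Z z) \<le> exp (t * card J)"
    if "z \<in> space (PiM J M)" "0 < t" for z and t :: real
  proof -
    have "\<bar>t * Z z\<bar> \<le> t * card J" using C[OF that(1)] that(2) unfolding abs_mult by (intro mult_mono) auto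
    thus "exp (- (t * card J)) \<le> exp (t * Z z)" "exp (t * Z z) \<le> exp (t * card J)" by (auto simp: abs_le_iff)
  qed
  have Fpos: "0 < F t" if t: "0 < t" for t
  proof -
    have "exp (- (t * card J)) \<le> F t"
      unfolding F_def using expb[OF _ t] by (intro PJ.integral_between[where u = "exp (t * card J)"]) auto
    thus ?thesis using exp_gt_zero less_le_trans by blast
  qed
  have chernoff: "measure (PiM J M) {z \<in> space (PiM J M). a \<le> Z z} \<le> exp (ln (F t) - t * a)" if t: "0 < t" for t
  proof -
    have "{z \<in> space (PiM J M). a \<le> Z z} = {z \<in> space (PiM J M). exp (t * a) \<le> exp (t * Z z)}"
      using t by auto
    also have "measure (PiM J M) \<dots> \<le> F t / exp (t * a)"
      unfolding F_def using expb[OF _ t]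
      by (intro integral_Markov_inequality_measure[where A = "space (PiM J M)"]
        PJ.integrable_bounded[where B = "exp (t * card J)"]) auto
    also have "\<dots> = exp (ln (F t) - t * a)" using Fpos[OF t] by (simp add: exp_diff)
    finally show ?thesis .
  qed
  have "\<exists>t>0. ln (F t) - t * a \<le> - x"
  \<comment> \<open>For \<open>v = 0\<close> the parameter chosen in the other case would be
    \<open>2\<close>, the pole of the sub-gamma bound. There the bound before this simplification is
    used directly at \<open>t = 2\<close>, and \<open>2 * (x / 2) = x\<close>.\<close>
  proof (cases "v = 0")
    case True
    hence "E = 0" "V = 0" using E V by (auto simp: v_def)
    hence "ln (F 2) \<le> 0" using mgf[of 2] by (simp add: F_def)
    thus ?thesis using True \<open>E = 0\<close> by (intro exI[of _ 2]) (simp add: a_def)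
  next
    case False
    hence v: "v > 0" using E V by (simp add: v_def)
    define s q where "s = sqrt x" and "q = sqrt v"
    have sq: "0 < s" "0 < q" "x = s\<^sup>2" "v = q\<^sup>2" "sqrt (x * v) = s * q"
      using x v by (auto simp: s_def q_def real_sqrt_mult)
    \<comment> \<open>The stationary point of
      \<open>2 * t^2 * v / (2 - t) - t * (2 * s * q + s^2 / 2)\<close>; the value attained there is
      exactly \<open>- s^2 = - x\<close>.\<close>
    define t where "t = 2 * s / (2 * q + s)"
    have t: "0 < t" "t < 2" using sq by (auto simp: t_def field_simps)
    have "ln (F t) \<le> t * E + 2 * t\<^sup>2 * v / (2 - t)"
      using mgf[of t] mgf_factor_le[OF t E V] t by (simp add: F_def v_def)
    moreover have "2 - t = 4 * q / (2 * q + s)"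
      using sq by (simp add: t_def field_simps)
    hence "2 * t\<^sup>2 * v / (2 - t) = 2 * s\<^sup>2 * q / (2 * q + s)"
    proof -
      have "2 * (2 * s / d)\<^sup>2 * q\<^sup>2 / (4 * q / d) = 2 * s\<^sup>2 * q / d" if "d > 0" for d
        using that sq by (simp add: field_simps power2_eq_square)
      from this[of "2 * q + s"] show ?thesis
        using sq \<open>2 - t = _\<close> by (simp only: t_def)
    qed
    moreover have "t * a = t * E + s\<^sup>2 * (4 * q + s) / (2 * q + s)"
    proof -
      have a: "a = E + (2 * (s * q) + s\<^sup>2 / 2)" using sq by (simp add: a_def)
      have "2 * s / d * (2 * (s * q) + s\<^sup>2 / 2) = s\<^sup>2 * (4 * q + s) / d" for d
        by (simp add: algebra_simps power2_eq_square add_divide_distrib)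
      hence "t * (2 * (s * q) + s\<^sup>2 / 2) = s\<^sup>2 * (4 * q + s) / (2 * q + s)" unfolding t_def .
      thus ?thesis unfolding a by (simp only: distrib_left[of t E])
    qed
    moreover have "2 * s\<^sup>2 * q / (2 * q + s) - s\<^sup>2 * (4 * q + s) / (2 * q + s) = - x"
    proof -
      have "2 * s\<^sup>2 * q - s\<^sup>2 * (4 * q + s) = - x * (2 * q + s)"
        unfolding sq(3) by (simp add: algebra_simps)
      moreover have "2 * q + s \<noteq> 0" using sq by simp
      ultimately show ?thesis by (simp flip: diff_divide_distrib)
    qed
    ultimately show ?thesis using t by (intro exI[of _ t]) simp
  qed
  then obtain t where "t > 0" "ln (F t) - t * a \<le> - x" by blast
  hence "measure (PiM J M) {z \<in> space (PiM J M). a \<le> Z z} \<le> exp (- x)"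
    using chernoff[of t] by (meson exp_le_cancel_iff order_trans)
  thus ?thesis by (simp add: a_def v_def)
qed

text \<open>Homogeneity: dividing the class by \<open>U\<close> divides \<open>E\<close> by
  \<open>U\<close> and \<open>V\<close> by \<open>U^2\<close>. The inequality in the event is strict
  because for \<open>U = 0\<close> all sums vanish and the threshold may be \<open>0\<close>
  too.\<close>

lemma (in product_prob_space) sup_concentration:
  fixes G :: "('i \<Rightarrow> 'a \<Rightarrow> real) set" and Z :: "('i \<Rightarrow> 'a) \<Rightarrow> real"
  assumes J: "finite J" "J \<noteq> {}" and G: "G \<noteq> {}"
    and meas: "\<And>g i. g \<in> G \<Longrightarrow> i \<in> J \<Longrightarrow> g i \<in> borel_measurable (M i)"
    and mean: "\<And>g i. g \<in> G \<Longrightarrow> i \<in> J \<Longrightarrow> (\<integral>y. g i y \<partial>M i) = 0"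
    and osc: "\<And>g i y y'. g \<in> G \<Longrightarrow> i \<in> J \<Longrightarrow> y \<in> space (M i) \<Longrightarrow> y' \<in> space (M i) \<Longrightarrow> g i y - g i y' \<le> U"
    and U: "0 \<le> U"
    and var: "\<And>g. g \<in> G \<Longrightarrow> (\<Sum>i\<in>J. \<integral>y. (g i y)\<^sup>2 \<partial>M i) \<le> V"
    and Z[measurable]: "Z \<in> borel_measurable (PiM J M)"
    and lub: "\<And>x c. x \<in> space (PiM J M) \<Longrightarrow> Z x \<le> c \<longleftrightarrow> (\<forall>g\<in>G. (\<Sum>i\<in>J. g i (x i)) \<le> c)"
    and x: "0 < x"
  defines "E \<equiv> \<integral>z. Z z \<partial>PiM J M"
  shows "measure (PiM J M) {z \<in> space (PiM J M). E + 2 * sqrt (x * (V + 2 * U * E)) + U * x / 2 < Z z} \<le> exp (- x)"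
    and "0 \<le> E"
proof -
  interpret PJ: prob_space "PiM J M" by (rule prob_space_PiM) (rule prob_space)
  have xi: "z i \<in> space (M i)" if "z \<in> space (PiM J M)" "i \<in> J" for z i
    using that by (auto simp: space_PiM PiE_def Pi_def)
  have gU: "\<bar>g i y\<bar> \<le> U" if "g \<in> G" "i \<in> J" "y \<in> space (M i)" for g i y
    using M.centered_abs_le[OF meas[OF that(1,2)] mean[OF that(1,2)] osc[OF that(1,2)] that(3)] .
  have S_abs: "\<bar>\<Sum>i\<in>J. g i (z i)\<bar> \<le> card J * U" if "g \<in> G" "z \<in> space (PiM J M)" for g z
  proof -
    have "\<bar>\<Sum>i\<in>J. g i (z i)\<bar> \<le> (\<Sum>i\<in>J. \<bar>g i (z i)\<bar>)" by (rule sum_abs)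
    also have "\<dots> \<le> (\<Sum>i\<in>J. U)" using that gU xi by (intro sum_mono) auto
    finally show ?thesis by simp
  qed
  have S_le: "(\<Sum>i\<in>J. g i (z i)) \<le> Z z" if "g \<in> G" "z \<in> space (PiM J M)" for g z
    using lub[OF that(2), of "Z z"] that(1) by simp
  obtain g0 where g0: "g0 \<in> G" using G by auto
  have Z_le: "Z z \<le> card J * U" if z: "z \<in> space (PiM J M)" for z
    using S_abs[OF _ z] by (subst lub[OF z]) (force simp: abs_le_iff)
  have C: "\<bar>Z z\<bar> \<le> card J * U" if z: "z \<in> space (PiM J M)" for z
    using Z_le[OF z] S_le[OF g0 z] S_abs[OF g0 z] by linarith
  have intZ: "integrable (PiM J M) Z" using C by (intro PJ.integrable_bounded) auto
  show E: "0 \<le> E"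
    unfolding E_def using g0 meas mean gU S_le
    by (intro sup_expectation_nonneg[OF J(1) g0 _ _ _ intZ, where c = U]) auto
  have "0 \<le> (\<Sum>i\<in>J. \<integral>y. (g0 i y)\<^sup>2 \<partial>M i)" by (intro sum_nonneg integral_nonneg) auto
  hence V: "0 \<le> V" using var[OF g0] by simp
  show "measure (PiM J M) {z \<in> space (PiM J M). E + 2 * sqrt (x * (V + 2 * U * E)) + U * x / 2 < Z z} \<le> exp (- x)"
  proof (cases "U = 0")
    case True
    have empty: "{z \<in> space (PiM J M). E + 2 * sqrt (x * (V + 2 * U * E)) + U * x / 2 < Z z} = {}"
    proof -
      have "Z z \<le> E + 2 * sqrt (x * V)" if "z \<in> space (PiM J M)" for z
        using Z_le[OF that] E V x True by (simp add: order_trans[of "Z z" 0])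
      thus ?thesis using True by (auto simp: not_less)
    qed
    show ?thesis unfolding empty by simp
  next
    case False
    hence U0: "U > 0" using U by simp
    define G' where "G' = (\<lambda>g i y. g i y / U) ` G"
    have E': "(\<integral>z. Z z / U \<partial>PiM J M) = E / U" by (simp add: E_def)
    have "measure (PiM J M) {z \<in> space (PiM J M).
        (\<integral>z. Z z / U \<partial>PiM J M) + 2 * sqrt (x * (V / U\<^sup>2 + 2 * (\<integral>z. Z z / U \<partial>PiM J M))) + x / 2 \<le> Z z / U} \<le> exp (- x)"
    proof (rule sup_concentration_unit[OF J, where G = G'])
      show "G' \<noteq> {}" using G by (simp add: G'_def)
      show "(\<Sum>i\<in>J. \<integral>y. (g i y)\<^sup>2 \<partial>M i) \<le> V / U\<^sup>2" if "g \<in> G'" for g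
        using that var U0 by (auto simp: G'_def power_divide divide_right_mono simp flip: sum_divide_distrib)
      show "Z z / U \<le> c \<longleftrightarrow> (\<forall>g\<in>G'. (\<Sum>i\<in>J. g i (z i)) \<le> c)" if "z \<in> space (PiM J M)" for z c
        using lub[OF that, of "c * U"] U0 by (simp add: G'_def field_simps flip: sum_divide_distrib)
      show "g i y - g i y' \<le> 1" if "g \<in> G'" "i \<in> J" "y \<in> space (M i)" "y' \<in> space (M i)" for g i y y'
        using that osc U0 by (auto simp: G'_def simp flip: diff_divide_distrib)
    qed (use meas mean x in \<open>auto simp: G'_def\<close>)
    also have "{z \<in> space (PiM J M).
        (\<integral>z. Z z / U \<partial>PiM J M) + 2 * sqrt (x * (V / U\<^sup>2 + 2 * (\<integral>z. Z z / U \<partial>PiM J M))) + x / 2 \<le> Z z / U}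
      = {z \<in> space (PiM J M). E + 2 * sqrt (x * (V + 2 * U * E)) + U * x / 2 \<le> Z z}"
    proof -
      have "x * (V / U\<^sup>2 + 2 * (E / U)) = x * (V + 2 * U * E) / U\<^sup>2"
        using U0 by (simp add: field_simps power2_eq_square)
      hence "sqrt (x * (V / U\<^sup>2 + 2 * (E / U))) = sqrt (x * (V + 2 * U * E)) / U"
        using U0 by (simp add: real_sqrt_divide)
      hence "E / U + 2 * sqrt (x * (V / U\<^sup>2 + 2 * (E / U))) + x / 2 = (E + 2 * sqrt (x * (V + 2 * U * E)) + U * x / 2) / U"
        using U0 by (simp add: field_simps)
      thus ?thesis using U0 unfolding E' by (simp add: divide_le_cancel)
    qed
    finally have "measure (PiM J M) {z \<in> space (PiM J M). E + 2 * sqrt (x * (V + 2 * U * E)) + U * x / 2 \<le> Z z} \<le> exp (- x)" .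
    moreover have "measure (PiM J M) {z \<in> space (PiM J M). E + 2 * sqrt (x * (V + 2 * U * E)) + U * x / 2 < Z z}
        \<le> measure (PiM J M) {z \<in> space (PiM J M). E + 2 * sqrt (x * (V + 2 * U * E)) + U * x / 2 \<le> Z z}"
      by (intro PJ.finite_measure_mono) auto
    ultimately show ?thesis by linarith
  qed
qed

section \<open>Symmetrization\<close>

text \<open>The exchange of coordinates with a ghost sample; restricting to \<open>J\<close> keeps
  the result in the space of \<open>PiM J M\<close>.\<close>

definition mix :: "'i set \<Rightarrow> 'i set \<Rightarrow> ('i \<Rightarrow> 'a) \<Rightarrow> ('i \<Rightarrow> 'a) \<Rightarrow> 'i \<Rightarrow> 'a" where
  "mix J P x y = (\<lambda>i\<in>J. if i \<in> P then x i else y i)"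

lemma measurable_mix[measurable]:
  "(\<lambda>(x, y). mix J P x y) \<in> PiM J M \<Otimes>\<^sub>M PiM J M \<rightarrow>\<^sub>M PiM J M"
proof (rule measurable_PiM_single')
  show "(\<lambda>\<omega>. (\<lambda>(x, y). mix J P x y) \<omega> i) \<in> PiM J M \<Otimes>\<^sub>M PiM J M \<rightarrow>\<^sub>M M i" if [simp]: "i \<in> J" for i
    by (cases "i \<in> P") (auto simp: case_prod_beta mix_def)
  show "(\<lambda>(x, y). mix J P x y) \<in> space (PiM J M \<Otimes>\<^sub>M PiM J M) \<rightarrow> (\<Pi>\<^sub>E i\<in>J. space (M i))"
    by (auto simp: space_pair_measure space_PiM PiE_def Pi_def mix_def)
qed

text \<open>The preimage of a box is a product of two boxes, and in each coordinate one of the two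
  sides is all of \<open>M i\<close>, of mass one.\<close>

lemma (in product_prob_space) distr_PiM_mix:
  assumes J: "finite J"
  shows "distr (PiM J M \<Otimes>\<^sub>M PiM J M) (PiM J M) (\<lambda>(x, y). mix J P x y) = PiM J M"
proof (rule PiM_eqI[OF J])
  interpret PJ: prob_space "PiM J M" by (rule prob_space_PiM) (rule prob_space)
  let ?h = "\<lambda>(x, y). mix J P x y"
  fix A assume A: "\<And>i. i \<in> J \<Longrightarrow> A i \<in> sets (M i)"
  define B C where "B i = (if i \<in> P then A i else space (M i))" and "C i = (if i \<in> P then space (M i) else A i)" for i
  have BC: "B i \<in> sets (M i)" "C i \<in> sets (M i)" if "i \<in> J" for i
    using A[OF that] by (auto simp: B_def C_def)
  have AS: "A i \<subseteq> space (M i)" if "i \<in> J" for i using A[OF that] by (rule sets.sets_into_space)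
  have "?h -` Pi\<^sub>E J A \<inter> space (PiM J M \<Otimes>\<^sub>M PiM J M) = Pi\<^sub>E J B \<times> Pi\<^sub>E J C"
  proof (intro set_eqI iffI)
    fix p assume "p \<in> ?h -` Pi\<^sub>E J A \<inter> space (PiM J M \<Otimes>\<^sub>M PiM J M)"
    thus "p \<in> Pi\<^sub>E J B \<times> Pi\<^sub>E J C"
      by (cases p) (auto simp: space_pair_measure space_PiM B_def C_def PiE_iff mix_def split: if_splits)
  next
    fix p assume "p \<in> Pi\<^sub>E J B \<times> Pi\<^sub>E J C"
    thus "p \<in> ?h -` Pi\<^sub>E J A \<inter> space (PiM J M \<Otimes>\<^sub>M PiM J M)"
      using AS BC[THEN sets.sets_into_space]
      by (cases p) (force simp: space_pair_measure space_PiM B_def C_def PiE_iff mix_def split: if_splits)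
  qed
  moreover have PA: "Pi\<^sub>E J A \<in> sets (PiM J M)" "Pi\<^sub>E J B \<in> sets (PiM J M)" "Pi\<^sub>E J C \<in> sets (PiM J M)"
    using A BC J by (auto intro!: sets_PiM_I_finite)
  ultimately have "emeasure (distr (PiM J M \<Otimes>\<^sub>M PiM J M) (PiM J M) ?h) (Pi\<^sub>E J A)
      = emeasure (PiM J M) (Pi\<^sub>E J B) * emeasure (PiM J M) (Pi\<^sub>E J C)"
    by (simp add: emeasure_distr PJ.emeasure_pair_measure_Times)
  also have "\<dots> = (\<Prod>i\<in>J. emeasure (M i) (B i) * emeasure (M i) (C i))"
    using J BC by (simp add: emeasure_PiM prod.distrib)
  also have "\<dots> = (\<Prod>i\<in>J. emeasure (M i) (A i))"
    by (intro prod.cong) (auto simp: B_def C_def M.emeasure_space_1)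
  finally show "emeasure (distr (PiM J M \<Otimes>\<^sub>M PiM J M) (PiM J M) ?h) (Pi\<^sub>E J A) = (\<Prod>i\<in>J. emeasure (M i) (A i))" .
qed simp

lemma (in product_prob_space) integral_mix:
  fixes f :: "('i \<Rightarrow> 'a) \<Rightarrow> real"
  assumes J: "finite J" and [measurable]: "f \<in> borel_measurable (PiM J M)"
    and B: "\<And>x. x \<in> space (PiM J M) \<Longrightarrow> \<bar>f x\<bar> \<le> B"
  shows "(\<integral>x. (\<integral>y. f (mix J P x y) \<partial>PiM J M) \<partial>PiM J M) = (\<integral>x. f x \<partial>PiM J M)"
proof -
  interpret PJ: prob_space "PiM J M" by (rule prob_space_PiM) (rule prob_space)
  interpret PP: pair_prob_space "PiM J M" "PiM J M" by unfold_locales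
  have "integrable (PiM J M \<Otimes>\<^sub>M PiM J M) (\<lambda>(x, y). f (mix J P x y))"
  proof (rule PP.integrable_bounded[where B = B])
    show "\<bar>case p of (x, y) \<Rightarrow> f (mix J P x y)\<bar> \<le> B" if "p \<in> space (PiM J M \<Otimes>\<^sub>M PiM J M)" for p
      using measurable_space[OF measurable_mix that] B by (auto simp: case_prod_beta)
  qed measurable
  hence "(\<integral>x. (\<integral>y. f (mix J P x y) \<partial>PiM J M) \<partial>PiM J M)
      = (\<integral>p. f (case p of (x, y) \<Rightarrow> mix J P x y) \<partial>(PiM J M \<Otimes>\<^sub>M PiM J M))"
    using PP.integral_fst'[of "\<lambda>(x, y). f (mix J P x y)"] by (simp add: case_prod_beta')
  also have "\<dots> = (\<integral>x. f x \<partial>distr (PiM J M \<Otimes>\<^sub>M PiM J M) (PiM J M) (\<lambda>(x, y). mix J P x y))"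
    by (simp add: integral_distr)
  also have "\<dots> = (\<integral>x. f x \<partial>PiM J M)" unfolding distr_PiM_mix[OF J] ..
  finally show ?thesis .
qed

text \<open>
  Symmetrization for one fixed sign pattern \<open>s\<close>. The coordinates with \<open>s i = 1\<close> and those with
  \<open>s i = -1\<close> are exchanged separately with a ghost sample, so that only the two signed suprema
  \<open>R\<close>, \<open>R'\<close> of a single sample occur; the supremum over pairs of samples, whose measurability is
  not assumed, is never integrated.
\<close>

lemma (in product_prob_space) symmetrization:
  fixes G :: "('i \<Rightarrow> 'a \<Rightarrow> real) set" and D R R' :: "('i \<Rightarrow> 'a) \<Rightarrow> real" and s :: "'i \<Rightarrow> real"
  assumes J: "finite J"
    and meas: "\<And>g i. g \<in> G \<Longrightarrow> i \<in> J \<Longrightarrow> g i \<in> borel_measurable (M i)"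
    and bound: "\<And>g i y. g \<in> G \<Longrightarrow> i \<in> J \<Longrightarrow> y \<in> space (M i) \<Longrightarrow> \<bar>g i y\<bar> \<le> c"
    and s: "\<And>i. i \<in> J \<Longrightarrow> s i \<in> {-1, 1}"
    and [measurable]: "R \<in> borel_measurable (PiM J M)" "R' \<in> borel_measurable (PiM J M)"
    and Rb: "\<And>x. x \<in> space (PiM J M) \<Longrightarrow> \<bar>R x\<bar> \<le> B" "\<And>x. x \<in> space (PiM J M) \<Longrightarrow> \<bar>R' x\<bar> \<le> B"
    and R: "\<And>g x. g \<in> G \<Longrightarrow> x \<in> space (PiM J M) \<Longrightarrow> (\<Sum>i\<in>J. s i * g i (x i)) \<le> R x"
    and R': "\<And>g x. g \<in> G \<Longrightarrow> x \<in> space (PiM J M) \<Longrightarrow> (\<Sum>i\<in>J. - s i * g i (x i)) \<le> R' x"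
    and D: "integrable (PiM J M) D"
    and D_le: "\<And>x c. x \<in> space (PiM J M) \<Longrightarrow>
      (\<And>g. g \<in> G \<Longrightarrow> (\<Sum>i\<in>J. (\<integral>y. g i y \<partial>M i) - g i (x i)) \<le> c) \<Longrightarrow> D x \<le> c"
  shows "(\<integral>x. D x \<partial>PiM J M) \<le> (\<integral>x. R x \<partial>PiM J M) + (\<integral>x. R' x \<partial>PiM J M)"
proof -
  interpret PJ: prob_space "PiM J M" by (rule prob_space_PiM) (rule prob_space)
  have mix_space: "mix J P x y \<in> space (PiM J M)" if "x \<in> space (PiM J M)" "y \<in> space (PiM J M)" for P x y
    using that by (auto simp: mix_def space_PiM PiE_def Pi_def)
  define P where "P = {i. s i = 1}"
  have xi: "x i \<in> space (M i)" if "x \<in> space (PiM J M)" "i \<in> J" for x i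
    using that by (auto simp: space_PiM PiE_def Pi_def)
  have gm: "(\<lambda>x. g i (x i)) \<in> borel_measurable (PiM J M)" if "g \<in> G" "i \<in> J" for g i
    by (rule measurable_compose[OF measurable_component_singleton[OF that(2)]]) (rule meas[OF that])
  have gint: "integrable (PiM J M) (\<lambda>x. g i (x i))" if "g \<in> G" "i \<in> J" for g i
    using bound[OF that xi[OF _ that(2)]] gm[OF that] by (intro PJ.integrable_bounded[where B = c]) auto
  have gE: "(\<integral>x. g i (x i) \<partial>PiM J M) = (\<integral>y. g i y \<partial>M i)" if "g \<in> G" "i \<in> J" for g i
    using integral_resample[where f = "\<lambda>x. g i (x i)" and B = c, OF J that(2) gm[OF that]]
      bound[OF that] xi that by (simp add: PJ.prob_space)
  have mix1[measurable]: "mix J P x \<in> PiM J M \<rightarrow>\<^sub>M PiM J M" if "x \<in> space (PiM J M)" for P x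
    using measurable_Pair2[OF measurable_mix[of J P M] that] by simp
  have intR: "integrable (PiM J M) (\<lambda>y. h (mix J P x y))"
    if "x \<in> space (PiM J M)" "h \<in> borel_measurable (PiM J M)"
      "\<And>x. x \<in> space (PiM J M) \<Longrightarrow> \<bar>h x\<bar> \<le> B" for P x and h :: "_ \<Rightarrow> real"
  proof (rule PJ.integrable_bounded[where B = B])
    show "(\<lambda>y. h (mix J P x y)) \<in> borel_measurable (PiM J M)"
      by (rule measurable_compose[OF mix1[OF that(1)] that(2)])
  qed (use that mix_space in auto)
  have "D x \<le> (\<integral>y. R' (mix J P x y) \<partial>PiM J M) + (\<integral>y. R (mix J (- P) x y) \<partial>PiM J M)"
    if x: "x \<in> space (PiM J M)" for x
  proof (rule D_le[OF x])
    fix g assume g: "g \<in> G"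
    have "(\<Sum>i\<in>J. (\<integral>y. g i y \<partial>M i) - g i (x i)) = (\<integral>y. (\<Sum>i\<in>J. g i (y i) - g i (x i)) \<partial>PiM J M)"
      using gint[OF g] gE[OF g]
      by (subst Bochner_Integration.integral_sum) (auto simp: PJ.prob_space)
    also have "\<dots> \<le> (\<integral>y. R' (mix J P x y) + R (mix J (- P) x y) \<partial>PiM J M)"
    proof (rule integral_mono)
      show "integrable (PiM J M) (\<lambda>y. \<Sum>i\<in>J. g i (y i) - g i (x i))"
        using gint[OF g] by (intro Bochner_Integration.integrable_sum) auto
      show "integrable (PiM J M) (\<lambda>y. R' (mix J P x y) + R (mix J (- P) x y))"
        using x Rb by (intro Bochner_Integration.integrable_add intR) auto
      fix y assume y: "y \<in> space (PiM J M)"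
      \<comment> \<open>For \<open>s i = 1\<close> the term \<open>- g i (x i)\<close> comes from
        the first sum and \<open>g i (y i)\<close> from the second; for \<open>s i = -1\<close> it
        is the other way round.\<close>
      have "(\<Sum>i\<in>J. g i (y i) - g i (x i))
          = (\<Sum>i\<in>J. - s i * g i (mix J P x y i)) + (\<Sum>i\<in>J. s i * g i (mix J (- P) x y i))"
        unfolding sum.distrib[symmetric] using s
        by (intro sum.cong) (fastforce simp: mix_def P_def)+
      also have "\<dots> \<le> R' (mix J P x y) + R (mix J (- P) x y)"
        using R[OF g mix_space[OF x y]] R'[OF g mix_space[OF x y]] by (intro add_mono) auto
      finally show "(\<Sum>i\<in>J. g i (y i) - g i (x i)) \<le> R' (mix J P x y) + R (mix J (- P) x y)" .
    qed
    also have "\<dots> = (\<integral>y. R' (mix J P x y) \<partial>PiM J M) + (\<integral>y. R (mix J (- P) x y) \<partial>PiM J M)"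
      using x Rb by (intro Bochner_Integration.integral_add intR) auto
    finally show "(\<Sum>i\<in>J. (\<integral>y. g i y \<partial>M i) - g i (x i))
      \<le> (\<integral>y. R' (mix J P x y) \<partial>PiM J M) + (\<integral>y. R (mix J (- P) x y) \<partial>PiM J M)" .
  qed
  moreover have intR': "integrable (PiM J M) (\<lambda>x. \<integral>y. h (mix J P x y) \<partial>PiM J M)"
    if [measurable]: "h \<in> borel_measurable (PiM J M)"
      and "\<And>x. x \<in> space (PiM J M) \<Longrightarrow> \<bar>h x\<bar> \<le> B" for P and h :: "_ \<Rightarrow> real"
  proof (rule PJ.integrable_bounded[where B = B])
    fix x assume x: "x \<in> space (PiM J M)"
    show "\<bar>\<integral>y. h (mix J P x y) \<partial>PiM J M\<bar> \<le> B"
      using that(2) mix_space[OF x] measurable_compose[OF mix1[OF x] that(1)]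
      by (intro PJ.abs_integral_le) auto
  qed (rule PJ.borel_measurable_lebesgue_integral, measurable)
  ultimately have "(\<integral>x. D x \<partial>PiM J M)
      \<le> (\<integral>x. (\<integral>y. R' (mix J P x y) \<partial>PiM J M) + (\<integral>y. R (mix J (- P) x y) \<partial>PiM J M) \<partial>PiM J M)"
    using D Rb by (intro integral_mono Bochner_Integration.integrable_add) auto
  also have "\<dots> = (\<integral>x. (\<integral>y. R' (mix J P x y) \<partial>PiM J M) \<partial>PiM J M) + (\<integral>x. (\<integral>y. R (mix J (- P) x y) \<partial>PiM J M) \<partial>PiM J M)"
    using Rb by (intro Bochner_Integration.integral_add intR') auto
  also have "\<dots> = (\<integral>x. R x \<partial>PiM J M) + (\<integral>x. R' x \<partial>PiM J M)"
    using integral_mix[OF J, of R' B P] integral_mix[OF J, of R B "- P"] Rb by simp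
  finally show ?thesis .
qed

section \<open>The multi-task setting\<close>

lemma sqrt_deviation_le:
  fixes E R V U x \<alpha> :: real
  assumes "0 \<le> E" "E \<le> 2 * R" "0 \<le> V" "0 \<le> U" "0 < x" and \<alpha>: "0 < \<alpha>"
  shows "E + 2 * sqrt (x * (V + 2 * U * E)) + U * x / 2
    \<le> 2 * (1 + \<alpha>) * R + 2 * sqrt (x * V) + (1 + 4 / \<alpha>) * (U * x / 2)"
proof -
  have "sqrt (x * (V + 2 * U * E)) \<le> sqrt (x * V) + sqrt (2 * x * U * E)"
    using assms sqrt_add_le_add_sqrt[of "x * V" "2 * x * U * E"] by (simp add: algebra_simps)
  \<comment> \<open>The factors are split so that the first joins \<open>E\<close> as
    \<open>(1 + \<alpha>) * E\<close>, while the second, \<open>2 * U * x / \<alpha>\<close>, is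
    \<open>4 / \<alpha>\<close> times \<open>U * x / 2\<close>.\<close>
  moreover have "sqrt (2 * x * U * E) = sqrt ((\<alpha> * E) * (2 * U * x / \<alpha>))"
    using \<alpha> by (simp add: field_simps)
  moreover have "\<dots> \<le> (\<alpha> * E + 2 * U * x / \<alpha>) / 2"
    using assms by (intro arith_geo_mean_sqrt) auto
  moreover have "(1 + \<alpha>) * E \<le> (1 + \<alpha>) * (2 * R)" using assms by (intro mult_left_mono) auto
  moreover have "(1 + 4 / \<alpha>) * (U * x / 2) = U * x / 2 + 2 * U * x / \<alpha>"
    by (simp add: algebra_simps)
  ultimately show ?thesis by (simp add: algebra_simps)
qed

section \<open>Rademacher signs and their symmetry\<close>

lemma prob_space_rademacher: "prob_space rademacher"
  unfolding rademacher_def by (intro prob_space_uniform_count_measure) auto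

lemma space_rademacher: "space rademacher = {-1, 1}"
  by (simp add: rademacher_def space_uniform_count_measure)

lemma distr_uminus_rademacher: "distr rademacher rademacher uminus = rademacher"
proof (rule measure_eqI)
  fix A assume "A \<in> sets (distr rademacher rademacher uminus)"
  hence A: "A \<subseteq> {-1, 1}" by (simp add: rademacher_def sets_uniform_count_measure)
  have m: "uminus \<in> rademacher \<rightarrow>\<^sub>M rademacher"
    by (auto simp: rademacher_def measurable_def space_uniform_count_measure sets_uniform_count_measure)
  have "emeasure (distr rademacher rademacher uminus) A = emeasure rademacher (uminus -` A \<inter> {-1, 1})"
    using A by (subst emeasure_distr[OF m]) (auto simp: rademacher_def sets_uniform_count_measure space_uniform_count_measure)
  also have "uminus -` A \<inter> {-1, 1} = uminus ` A"
    using A by force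
  also have "emeasure rademacher (uminus ` A) = emeasure rademacher A"
    using A by (subst (1 2) rademacher_def, subst (1 2) emeasure_uniform_count_measure)
      (auto simp: card_image)
  finally show "emeasure (distr rademacher rademacher uminus) A = emeasure rademacher A" .
qed simp

text \<open>Negation preserves each factor, hence the product. Once the signs are averaged, this
  identifies the two signed suprema that symmetrization leaves.\<close>

lemma integral_sign_flip:
  fixes h :: "_ \<Rightarrow> real"
  assumes "finite J" and h: "h \<in> borel_measurable (PiM J (\<lambda>_. rademacher))"
  defines "flip \<equiv> \<lambda>s. \<lambda>i\<in>J. - s i"
  shows "(\<integral>s. h (flip s) \<partial>PiM J (\<lambda>_. rademacher)) = (\<integral>s. h s \<partial>PiM J (\<lambda>_. rademacher))"
    and "flip \<in> PiM J (\<lambda>_. rademacher) \<rightarrow>\<^sub>M PiM J (\<lambda>_. rademacher)"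
proof -
  have m: "uminus \<in> rademacher \<rightarrow>\<^sub>M rademacher"
    by (auto simp: rademacher_def measurable_def space_uniform_count_measure sets_uniform_count_measure)
  show mf: "flip \<in> PiM J (\<lambda>_. rademacher) \<rightarrow>\<^sub>M PiM J (\<lambda>_. rademacher)"
    unfolding flip_def
  proof (rule measurable_restrict)
    show "(\<lambda>s. - s i) \<in> PiM J (\<lambda>_. rademacher) \<rightarrow>\<^sub>M rademacher" if "i \<in> J" for i
      by (rule measurable_compose[OF measurable_component_singleton[OF that] m])
  qed
  have "distr (PiM J (\<lambda>_. rademacher)) (PiM J (\<lambda>_. rademacher)) flip = PiM J (\<lambda>_. distr rademacher rademacher uminus)"
    unfolding flip_def
    using distr_PiM_finite_prob_space'[OF assms(1), of "\<lambda>_. rademacher" "\<lambda>_. rademacher" uminus]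
    by (simp add: prob_space_rademacher m compose_def[abs_def])
  hence d: "distr (PiM J (\<lambda>_. rademacher)) (PiM J (\<lambda>_. rademacher)) flip = PiM J (\<lambda>_. rademacher)"
    by (simp add: distr_uminus_rademacher)
  show "(\<integral>s. h (flip s) \<partial>PiM J (\<lambda>_. rademacher)) = (\<integral>s. h s \<partial>PiM J (\<lambda>_. rademacher))"
    using integral_distr[OF mf h] by (simp add: d)
qed

section \<open>The sample and the signs as elements of product spaces\<close>

locale multitask = prob_space M for M :: "'w measure" +
  fixes \<mu> :: "nat \<Rightarrow> 'a measure" and T :: nat and N :: "nat \<Rightarrow> nat"
    and X :: "nat \<Rightarrow> nat \<Rightarrow> 'w \<Rightarrow> 'a" and \<sigma> :: "nat \<Rightarrow> nat \<Rightarrow> 'w \<Rightarrow> real"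
    and F :: "(nat \<Rightarrow> 'a \<Rightarrow> real) set" and b :: real
  assumes T: "T \<ge> 1" and N: "\<forall>t\<in>{1..T}. N t \<ge> 1"
    and sample: "multitask_sample M T N \<mu> X"
    and signs: "rademacher_signs M T N \<sigma>"
    and signs_indep: "signs_indep_of_sample M T N \<mu> X \<sigma>"
    and F: "F \<noteq> {}"
    and F_meas: "\<forall>f\<in>F. \<forall>t\<in>{1..T}. f t \<in> borel_measurable (\<mu> t)"
    and F_bound: "\<forall>f\<in>F. \<forall>t\<in>{1..T}. \<forall>y\<in>space (\<mu> t). \<bar>f t y\<bar> \<le> b"
    and sup_meas: "measurable_suprema M T N \<mu> X F"
begin

definition I where "I = sample_index T N"
definition w :: "nat \<Rightarrow> real" where "w t = 1 / (real T * real (N t))"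
text \<open>\<open>product_prob_space\<close> asks for a probability measure at every index, also
  outside \<open>I\<close>. The filler \<open>\<mu> 1\<close> is one, being the law of
  \<open>X 1 1\<close>.\<close>

definition \<nu> :: "nat \<times> nat \<Rightarrow> 'a measure" where "\<nu> k = (if fst k \<in> {1..T} then \<mu> (fst k) else \<mu> 1)"
definition m :: "(nat \<Rightarrow> 'a \<Rightarrow> real) \<Rightarrow> nat \<Rightarrow> real" where "m f t = (\<integral>y. f t y \<partial>\<mu> t)"
definition \<xi> :: "'w \<Rightarrow> nat \<times> nat \<Rightarrow> 'a" where "\<xi> \<omega> = (\<lambda>(t, i)\<in>I. X t i \<omega>)"
definition \<zeta> :: "'w \<Rightarrow> nat \<times> nat \<Rightarrow> real" where "\<zeta> \<omega> = (\<lambda>(t, i)\<in>I. \<sigma> t i \<omega>)"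

lemma finite_I: "finite I" by (simp add: I_def sample_index_def)

lemma I_iff: "(t, i) \<in> I \<longleftrightarrow> t \<in> {1..T} \<and> i \<in> {1..N t}"
  by (auto simp: I_def sample_index_def)

lemma in_I: "k \<in> I \<Longrightarrow> fst k \<in> {1..T}" by (cases k) (simp add: I_iff)

lemma first_in_I: "t \<in> {1..T} \<Longrightarrow> (t, 1) \<in> I" using N by (simp add: I_iff)

lemma I_nonempty: "I \<noteq> {}" using T first_in_I[of 1] by auto

lemma X_measurable: "(t, i) \<in> I \<Longrightarrow> X t i \<in> M \<rightarrow>\<^sub>M \<mu> t"
  using sample by (fastforce simp: multitask_sample_def indep_vars_def I_def)

lemma X_distr: "(t, i) \<in> I \<Longrightarrow> distr M (\<mu> t) (X t i) = \<mu> t"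
  using sample by (simp add: multitask_sample_def I_iff)

lemma prob_space_\<mu>: "t \<in> {1..T} \<Longrightarrow> prob_space (\<mu> t)"
  using prob_space_distr[OF X_measurable[OF first_in_I]] X_distr[OF first_in_I] by fastforce

lemma prob_space_\<nu>: "prob_space (\<nu> k)"
  using prob_space_\<mu> T by (simp add: \<nu>_def)

lemma \<nu>_eq: "k \<in> I \<Longrightarrow> \<nu> k = \<mu> (fst k)" using in_I by (auto simp: \<nu>_def)

lemma sample_space_eq: "sample_space T N \<mu> = PiM I \<nu>"
  unfolding sample_space_def I_def[symmetric]
  by (intro PiM_cong) (auto simp: \<nu>_eq)

lemma sign_space_eq: "sign_space T N = PiM I (\<lambda>_. rademacher)"
  by (simp add: sign_space_def I_def)

lemma product_prob_space_\<nu>: "product_prob_space \<nu>"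
  unfolding product_prob_space_def product_prob_space_axioms_def product_sigma_finite_def
  by (simp add: prob_space_\<nu> prob_space_imp_sigma_finite)

lemma \<xi>_measurable: "\<xi> \<in> M \<rightarrow>\<^sub>M PiM I \<nu>"
  unfolding \<xi>_def using X_measurable by (intro measurable_restrict) (auto simp: \<nu>_eq)

lemma \<xi>_distr: "distr M (PiM I \<nu>) \<xi> = PiM I \<nu>"
proof -
  have "distr M (PiM I (\<lambda>(t, i). \<mu> t)) (\<lambda>\<omega>. \<lambda>k\<in>I. (case k of (t, i) \<Rightarrow> X t i) \<omega>)
      = PiM I (\<lambda>k. distr M (case k of (t, i) \<Rightarrow> \<mu> t) (case k of (t, i) \<Rightarrow> X t i))"
    using sample X_measurable
    by (intro indep_vars_iff_distr_eq_PiM'[THEN iffD1] I_nonempty) (auto simp: multitask_sample_def I_def)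
  also have "\<dots> = PiM I \<nu>"
    using X_distr by (intro PiM_cong) (auto simp: \<nu>_eq)
  also have "PiM I (\<lambda>(t, i). \<mu> t) = PiM I \<nu>"
    by (intro PiM_cong) (auto simp: \<nu>_eq)
  also have "(\<lambda>\<omega>. \<lambda>k\<in>I. (case k of (t, i) \<Rightarrow> X t i) \<omega>) = \<xi>"
    by (auto simp: \<xi>_def fun_eq_iff restrict_def)
  finally show ?thesis .
qed

lemma \<sigma>_measurable: "(t, i) \<in> I \<Longrightarrow> \<sigma> t i \<in> M \<rightarrow>\<^sub>M rademacher"
  using signs by (fastforce simp: rademacher_signs_def indep_vars_def I_def)

lemma \<zeta>_measurable: "\<zeta> \<in> M \<rightarrow>\<^sub>M PiM I (\<lambda>_. rademacher)"
  unfolding \<zeta>_def using \<sigma>_measurable by (intro measurable_restrict) auto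

lemma \<zeta>_distr: "distr M (PiM I (\<lambda>_. rademacher)) \<zeta> = PiM I (\<lambda>_. rademacher)"
proof -
  have "distr M (PiM I (\<lambda>_. rademacher)) (\<lambda>\<omega>. \<lambda>k\<in>I. (case k of (t, i) \<Rightarrow> \<sigma> t i) \<omega>)
      = PiM I (\<lambda>k. distr M rademacher (case k of (t, i) \<Rightarrow> \<sigma> t i))"
    using signs \<sigma>_measurable
    by (intro indep_vars_iff_distr_eq_PiM'[THEN iffD1] I_nonempty) (auto simp: rademacher_signs_def I_def)
  also have "\<dots> = PiM I (\<lambda>_. rademacher)"
    using signs by (intro PiM_cong) (auto simp: rademacher_signs_def I_iff)
  also have "(\<lambda>\<omega>. \<lambda>k\<in>I. (case k of (t, i) \<Rightarrow> \<sigma> t i) \<omega>) = \<zeta>"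
    by (auto simp: \<zeta>_def fun_eq_iff restrict_def)
  finally show ?thesis .
qed

text \<open>Rectangles determine the product measure, and their preimages lie in the two independent
  sigma-algebras. This opens the Rademacher complexity to Fubini's theorem.\<close>

lemma joint_distr:
  "distr M (PiM I \<nu> \<Otimes>\<^sub>M PiM I (\<lambda>_. rademacher)) (\<lambda>\<omega>. (\<xi> \<omega>, \<zeta> \<omega>)) = PiM I \<nu> \<Otimes>\<^sub>M PiM I (\<lambda>_. rademacher)"
proof (rule pair_measure_eqI[symmetric])
  note [measurable] = \<xi>_measurable \<zeta>_measurable
  show "sigma_finite_measure (PiM I \<nu>)" "sigma_finite_measure (PiM I (\<lambda>_. rademacher))"
    by (intro prob_space_imp_sigma_finite prob_space_PiM prob_space_\<nu> prob_space_rademacher)+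
  fix A B assume A: "A \<in> sets (PiM I \<nu>)" and B: "B \<in> sets (PiM I (\<lambda>_. rademacher))"
  have 1: "\<xi> -` A \<inter> space M \<in> sets (vimage_algebra (space M) (\<lambda>\<omega>. \<lambda>(t, i)\<in>sample_index T N. X t i \<omega>) (sample_space T N \<mu>))"
    using A unfolding \<xi>_def[abs_def] I_def[symmetric] sample_space_eq by (rule in_vimage_algebra)
  have 2: "\<zeta> -` B \<inter> space M \<in> sets (vimage_algebra (space M) (\<lambda>\<omega>. \<lambda>(t, i)\<in>sample_index T N. \<sigma> t i \<omega>) (sign_space T N))"
    using B unfolding \<zeta>_def[abs_def] I_def[symmetric] sign_space_eq by (rule in_vimage_algebra)
  have "prob ((\<xi> -` A \<inter> space M) \<inter> (\<zeta> -` B \<inter> space M)) = prob (\<xi> -` A \<inter> space M) * prob (\<zeta> -` B \<inter> space M)"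
    using signs_indep 1 2 unfolding signs_indep_of_sample_def by (intro indep_setD)
  moreover have "(\<lambda>\<omega>. (\<xi> \<omega>, \<zeta> \<omega>)) -` (A \<times> B) \<inter> space M = (\<xi> -` A \<inter> space M) \<inter> (\<zeta> -` B \<inter> space M)"
    by auto
  ultimately have "emeasure (distr M (PiM I \<nu> \<Otimes>\<^sub>M PiM I (\<lambda>_. rademacher)) (\<lambda>\<omega>. (\<xi> \<omega>, \<zeta> \<omega>))) (A \<times> B)
      = emeasure (distr M (PiM I \<nu>) \<xi>) A * emeasure (distr M (PiM I (\<lambda>_. rademacher)) \<zeta>) B"
    using A B by (simp add: emeasure_distr emeasure_eq_measure ennreal_mult)
  thus "emeasure (PiM I \<nu>) A * emeasure (PiM I (\<lambda>_. rademacher)) B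
      = emeasure (distr M (PiM I \<nu> \<Otimes>\<^sub>M PiM I (\<lambda>_. rademacher)) (\<lambda>\<omega>. (\<xi> \<omega>, \<zeta> \<omega>))) (A \<times> B)"
    by (simp add: \<xi>_distr \<zeta>_distr)
qed simp

section \<open>Averages as weighted sums over one index set\<close>

lemma sum_I: "(\<Sum>t=1..T. \<Sum>i=1..N t. h (t, i)) = (\<Sum>k\<in>I. h k :: real)"
  unfolding I_def sample_index_def by (subst sum.Sigma) auto

lemma weighted_sum_I:
  "1 / real T * (\<Sum>t=1..T. 1 / real (N t) * (\<Sum>i=1..N t. h (t, i))) = (\<Sum>k\<in>I. w (fst k) * h k)"
  unfolding sum_I[symmetric] w_def by (simp add: sum_distrib_left mult.assoc)

text \<open>Task \<open>t\<close> contributes \<open>N t\<close> equal terms, which cancel the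
  factor \<open>1 / N t\<close> of its weight. It serves the true mean and, with a second weight
  kept inside \<open>a\<close>, the sum of the variances.\<close>

lemma weighted_sum_I_fst:
  "(\<Sum>k\<in>I. w (fst k) * a (fst k)) = 1 / real T * (\<Sum>t=1..T. a t)"
proof -
  have "1 / real T * (\<Sum>t=1..T. 1 / real (N t) * (\<Sum>i=1..N t. a (fst (t, i)))) = 1 / real T * (\<Sum>t=1..T. a t)"
  proof (intro arg_cong2[where f = "(*)"] sum.cong refl)
    fix t assume "t \<in> {1..T}"
    hence "real (N t) \<noteq> 0" using N by fastforce
    thus "1 / real (N t) * (\<Sum>i=1..N t. a (fst (t, i))) = a t" by simp
  qed
  with weighted_sum_I[of "\<lambda>k. a (fst k)"] show ?thesis by (rule trans[OF sym])
qed

lemma true_mean_eq: "f \<in> F \<Longrightarrow> true_mean M T X f = (\<Sum>k\<in>I. w (fst k) * m f (fst k))"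
proof -
  assume f: "f \<in> F"
  have "expectation (\<lambda>\<omega>. f t (X t 1 \<omega>)) = m f t" if t: "t \<in> {1..T}" for t
    using integral_distr[OF X_measurable[OF first_in_I[OF t]], of "f t"] f t F_meas
      X_distr[OF first_in_I[OF t]] by (simp add: m_def)
  thus ?thesis unfolding true_mean_def weighted_sum_I_fst by simp
qed

lemma variance_eq:
  assumes f: "f \<in> F" and t: "t \<in> {1..T}"
  shows "variance (\<lambda>\<omega>. f t (X t 1 \<omega>)) = (\<integral>y. (f t y - m f t)\<^sup>2 \<partial>\<mu> t)"
proof -
  note X1 = X_measurable[OF first_in_I[OF t]] X_distr[OF first_in_I[OF t]]
  have [measurable]: "f t \<in> borel_measurable (\<mu> t)" using f t F_meas by auto
  have "expectation (\<lambda>\<omega>. f t (X t 1 \<omega>)) = m f t"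
    using integral_distr[OF X1(1), of "f t"] X1(2) by (simp add: m_def)
  thus ?thesis
    using integral_distr[OF X1(1), of "\<lambda>y. (f t y - m f t)\<^sup>2"] X1(2) by simp
qed

lemma empirical_mean_eq: "empirical_mean T N f (curry z) = (\<Sum>k\<in>I. w (fst k) * f (fst k) (z k))"
  unfolding empirical_mean_def using weighted_sum_I[of "\<lambda>k. f (fst k) (z k)"] by simp

lemma empirical_mean_X: "empirical_mean T N f (\<lambda>t i. X t i \<omega>) = empirical_mean T N f (curry (\<xi> \<omega>))"
  unfolding empirical_mean_def by (intro arg_cong2[where f = "(*)"] sum.cong refl) (simp add: \<xi>_def I_iff)

lemma rademacher_sup_eq:
  "rademacher_sup T N F (curry z) (curry s) = (SUP f\<in>F. \<Sum>k\<in>I. s k * (w (fst k) * f (fst k) (z k)))"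
proof -
  have "1 / real T * (\<Sum>t=1..T. 1 / real (N t) * (\<Sum>i=1..N t. curry s t i * f t (curry z t i)))
      = (\<Sum>k\<in>I. s k * (w (fst k) * f (fst k) (z k)))" for f
    using weighted_sum_I[of "\<lambda>k. s k * f (fst k) (z k)"] by (simp add: mult.left_commute)
  thus ?thesis unfolding rademacher_sup_def by simp
qed

lemma rademacher_sup_X:
  "rademacher_sup T N F (\<lambda>t i. X t i \<omega>) (\<lambda>t i. \<sigma> t i \<omega>) = rademacher_sup T N F (curry (\<xi> \<omega>)) (curry (\<zeta> \<omega>))"
  unfolding rademacher_sup_def
  by (intro arg_cong[where f = Sup] image_cong refl arg_cong2[where f = "(*)"] sum.cong) (simp_all add: \<xi>_def \<zeta>_def I_iff)

lemma sample_in_space: "z \<in> space (PiM I \<nu>) \<Longrightarrow> k \<in> I \<Longrightarrow> z k \<in> space (\<mu> (fst k))"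
  using \<nu>_eq[of k] by (fastforce simp: space_PiM PiE_iff)

lemma sign_in_space: "s \<in> space (PiM I (\<lambda>_. rademacher)) \<Longrightarrow> k \<in> I \<Longrightarrow> s k \<in> {-1, 1}"
  by (auto simp: space_PiM PiE_iff space_rademacher)

lemma w_pos: "t \<in> {1..T} \<Longrightarrow> 0 < w t"
  using T N by (fastforce simp: w_def)

lemma f_bound: "f \<in> F \<Longrightarrow> t \<in> {1..T} \<Longrightarrow> y \<in> space (\<mu> t) \<Longrightarrow> \<bar>f t y\<bar> \<le> b"
  using F_bound by auto

lemma b_nonneg: "0 \<le> b"
proof -
  obtain f where "f \<in> F" using F by auto
  moreover obtain y where "y \<in> space (\<mu> 1)"
    using prob_space.not_empty[OF prob_space_\<mu>[of 1]] T by auto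
  ultimately show ?thesis using f_bound[of f 1 y] T by force
qed

lemma f_measurable: "f \<in> F \<Longrightarrow> t \<in> {1..T} \<Longrightarrow> f t \<in> borel_measurable (\<mu> t)"
  using F_meas by auto

lemma m_bound:
  assumes "f \<in> F" "t \<in> {1..T}"
  shows "\<bar>m f t\<bar> \<le> b"
  unfolding m_def using assms F_meas f_bound
  by (intro prob_space.abs_integral_le[OF prob_space_\<mu>]) auto

lemma signed_sum_bound:
  assumes "f \<in> F" "z \<in> space (PiM I \<nu>)" "s \<in> space (PiM I (\<lambda>_. rademacher))"
  shows "\<bar>\<Sum>k\<in>I. s k * (w (fst k) * f (fst k) (z k))\<bar> \<le> (\<Sum>k\<in>I. w (fst k) * b)"
proof (rule order_trans[OF sum_abs sum_mono])
  fix k assume k: "k \<in> I"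
  have "\<bar>s k\<bar> = 1" using sign_in_space[OF assms(3) k] by auto
  moreover have "w (fst k) * \<bar>f (fst k) (z k)\<bar> \<le> w (fst k) * b"
    using w_pos[OF in_I[OF k]] f_bound[OF assms(1) in_I[OF k] sample_in_space[OF assms(2) k]]
    by (intro mult_left_mono) auto
  ultimately show "\<bar>s k * (w (fst k) * f (fst k) (z k))\<bar> \<le> w (fst k) * b"
    using w_pos[OF in_I[OF k]] by (simp add: abs_mult)
qed

lemma rademacher_sup_upper:
  assumes "f \<in> F" "z \<in> space (PiM I \<nu>)" "s \<in> space (PiM I (\<lambda>_. rademacher))"
  shows "(\<Sum>k\<in>I. s k * (w (fst k) * f (fst k) (z k))) \<le> rademacher_sup T N F (curry z) (curry s)"
  unfolding rademacher_sup_eq using assms(1)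
proof (rule cSUP_upper)
  show "bdd_above ((\<lambda>f. \<Sum>k\<in>I. s k * (w (fst k) * f (fst k) (z k))) ` F)"
    using signed_sum_bound[OF _ assms(2,3)]
    by (intro bdd_aboveI[of _ "\<Sum>k\<in>I. w (fst k) * b"]) (auto simp: abs_le_iff)
qed

lemma rademacher_sup_bound:
  assumes "z \<in> space (PiM I \<nu>)" "s \<in> space (PiM I (\<lambda>_. rademacher))"
  shows "\<bar>rademacher_sup T N F (curry z) (curry s)\<bar> \<le> (\<Sum>k\<in>I. w (fst k) * b)"
proof -
  obtain f where f: "f \<in> F" using F by auto
  have "rademacher_sup T N F (curry z) (curry s) \<le> (\<Sum>k\<in>I. w (fst k) * b)"
    unfolding rademacher_sup_eq using signed_sum_bound[OF _ assms]
    by (intro cSUP_least F) (auto simp: abs_le_iff)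
  thus ?thesis using rademacher_sup_upper[OF f assms] signed_sum_bound[OF f assms] by linarith
qed

lemma rademacher_sup_measurable:
  "(\<lambda>(z, s). rademacher_sup T N F (curry z) (curry s)) \<in> borel_measurable (PiM I \<nu> \<Otimes>\<^sub>M PiM I (\<lambda>_. rademacher))"
  using sup_meas by (simp add: measurable_suprema_def sample_space_eq sign_space_eq)

text \<open>The signs form the outer integral because symmetrization is carried out for one fixed
  sign pattern.\<close>

lemma rademacher_complexity_eq:
  "rademacher_complexity M T N X \<sigma> F
    = (\<integral>s. (\<integral>z. rademacher_sup T N F (curry z) (curry s) \<partial>PiM I \<nu>) \<partial>PiM I (\<lambda>_. rademacher))"
    (is "?lhs = (\<integral>s. (\<integral>z. ?R z s \<partial>?S) \<partial>?E)")
proof -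
  interpret S: prob_space ?S by (intro prob_space_PiM prob_space_\<nu>)
  interpret E: prob_space ?E by (intro prob_space_PiM prob_space_rademacher)
  interpret SE: pair_prob_space ?S ?E by unfold_locales
  note [measurable] = \<xi>_measurable \<zeta>_measurable rademacher_sup_measurable
  have "?lhs = (\<integral>\<omega>. (\<lambda>(z, s). ?R z s) (\<xi> \<omega>, \<zeta> \<omega>) \<partial>M)"
    unfolding rademacher_complexity_def rademacher_sup_X by simp
  also have "\<dots> = (\<integral>p. (\<lambda>(z, s). ?R z s) p \<partial>distr M (?S \<Otimes>\<^sub>M ?E) (\<lambda>\<omega>. (\<xi> \<omega>, \<zeta> \<omega>)))"
    by (rule integral_distr[symmetric]) measurable
  also have "\<dots> = (\<integral>p. (\<lambda>(z, s). ?R z s) p \<partial>(?S \<Otimes>\<^sub>M ?E))"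
    unfolding joint_distr ..
  also have "\<dots> = (\<integral>s. (\<integral>z. ?R z s \<partial>?S) \<partial>?E)"
  proof (rule SE.integral_snd[symmetric])
    show "integrable (?S \<Otimes>\<^sub>M ?E) (\<lambda>(z, s). ?R z s)"
      using rademacher_sup_bound rademacher_sup_measurable
      by (intro SE.integrable_bounded[where B = "\<Sum>k\<in>I. w (fst k) * b"]) (auto simp: space_pair_measure)
  qed
  finally show ?thesis .
qed

text \<open>\<open>e = 1\<close> and \<open>e = -1\<close> give the two directions of the theorem;
  carrying \<open>e\<close> along treats both at once.\<close>

definition deviation :: "real \<Rightarrow> (nat \<times> nat \<Rightarrow> 'a) \<Rightarrow> real" where
  "deviation e z = (SUP f\<in>F. e * (true_mean M T X f - empirical_mean T N f (curry z)))"

lemma deviation_measurable: "e \<in> {-1, 1} \<Longrightarrow> deviation e \<in> borel_measurable (PiM I \<nu>)"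
  using sup_meas by (auto simp: measurable_suprema_def sample_space_eq deviation_def[abs_def])

lemma deviation_sum:
  "f \<in> F \<Longrightarrow> e * (true_mean M T X f - empirical_mean T N f (curry z))
    = (\<Sum>k\<in>I. e * (w (fst k) * (m f (fst k) - f (fst k) (z k))))"
  by (simp add: true_mean_eq empirical_mean_eq right_diff_distrib sum_subtractf flip: sum_distrib_left)

text \<open>Boundedness of the class makes \<open>SUP\<close> a genuine least upper bound. This is
  the universal property that both concentration and symmetrization expect.\<close>

lemma deviation_le_iff:
  assumes e: "e \<in> {-1, 1}" and z: "z \<in> space (PiM I \<nu>)"
  shows "deviation e z \<le> c \<longleftrightarrow> (\<forall>f\<in>F. (\<Sum>k\<in>I. e * (w (fst k) * (m f (fst k) - f (fst k) (z k)))) \<le> c)"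
proof -
  have "(\<Sum>k\<in>I. e * (w (fst k) * (m f (fst k) - f (fst k) (z k)))) \<le> (\<Sum>k\<in>I. w (fst k) * (2 * b))" if f: "f \<in> F" for f
  proof (rule sum_mono)
    fix k assume k: "k \<in> I"
    have "e * (w (fst k) * (m f (fst k) - f (fst k) (z k))) \<le> w (fst k) * \<bar>m f (fst k) - f (fst k) (z k)\<bar>"
      using e w_pos[OF in_I[OF k]] by (auto simp flip: mult_minus_right intro!: mult_left_mono)
    also have "\<dots> \<le> w (fst k) * (2 * b)"
      using w_pos[OF in_I[OF k]] m_bound[OF f in_I[OF k]] f_bound[OF f in_I[OF k] sample_in_space[OF z k]]
      by (intro mult_left_mono) auto
    finally show "e * (w (fst k) * (m f (fst k) - f (fst k) (z k))) \<le> w (fst k) * (2 * b)" .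
  qed
  hence "bdd_above ((\<lambda>f. e * (true_mean M T X f - empirical_mean T N f (curry z))) ` F)"
    by (intro bdd_aboveI[of _ "\<Sum>k\<in>I. w (fst k) * (2 * b)"]) (auto simp: deviation_sum)
  thus ?thesis
    unfolding deviation_def by (subst cSUP_le_iff[OF F]) (auto simp: deviation_sum)
qed

lemma deviation_bound:
  assumes e: "e \<in> {-1, 1}" and z: "z \<in> space (PiM I \<nu>)"
  shows "\<bar>deviation e z\<bar> \<le> (\<Sum>k\<in>I. w (fst k) * (2 * b))"
proof -
  have S: "\<bar>\<Sum>k\<in>I. e * (w (fst k) * (m f (fst k) - f (fst k) (z k)))\<bar> \<le> (\<Sum>k\<in>I. w (fst k) * (2 * b))" if f: "f \<in> F" for f
  proof (rule order_trans[OF sum_abs sum_mono])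
    fix k assume k: "k \<in> I"
    have "\<bar>e\<bar> = 1" using e by auto
    moreover have "w (fst k) * \<bar>m f (fst k) - f (fst k) (z k)\<bar> \<le> w (fst k) * (2 * b)"
      using w_pos[OF in_I[OF k]] m_bound[OF f in_I[OF k]] f_bound[OF f in_I[OF k] sample_in_space[OF z k]]
      by (intro mult_left_mono) auto
    ultimately show "\<bar>e * (w (fst k) * (m f (fst k) - f (fst k) (z k)))\<bar> \<le> w (fst k) * (2 * b)"
      using w_pos[OF in_I[OF k]] by (simp add: abs_mult)
  qed
  obtain f where f: "f \<in> F" using F by auto
  have "deviation e z \<le> (\<Sum>k\<in>I. w (fst k) * (2 * b))"
    using S by (subst deviation_le_iff[OF e z]) (auto simp: abs_le_iff)
  moreover have "(\<Sum>k\<in>I. e * (w (fst k) * (m f (fst k) - f (fst k) (z k)))) \<le> deviation e z"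
    using deviation_le_iff[OF e z, of "deviation e z"] f by simp
  ultimately show ?thesis using S[OF f] by linarith
qed

text \<open>For a fixed pattern \<open>s\<close> symmetrization leaves
  \<open>r s + r (flip s)\<close>. Flipping preserves the law of the signs, so averaging over
  \<open>s\<close> gives the complexity twice.\<close>

lemma expectation_deviation_le:
  assumes e: "e \<in> {-1, 1}"
  shows "(\<integral>z. deviation e z \<partial>PiM I \<nu>) \<le> 2 * rademacher_complexity M T N X \<sigma> F"
proof -
  let ?E = "PiM I (\<lambda>_. rademacher)"
  interpret S: prob_space "PiM I \<nu>" by (intro prob_space_PiM prob_space_\<nu>)
  interpret Q: product_prob_space \<nu> I by (rule product_prob_space_\<nu>)
  interpret E: prob_space ?E by (intro prob_space_PiM prob_space_rademacher)
  note [measurable] = rademacher_sup_measurable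
  define R where "R s z = rademacher_sup T N F (curry z) (curry s)" for z s
  define flip where "flip s = (\<lambda>k\<in>I. - s k)" for s :: "nat \<times> nat \<Rightarrow> real"
  define B where "B = (\<Sum>k\<in>I. w (fst k) * b)"
  have RB: "\<bar>R s z\<bar> \<le> B" if "z \<in> space (PiM I \<nu>)" "s \<in> space ?E" for z s
    unfolding R_def B_def by (rule rademacher_sup_bound[OF that])
  have Rm[measurable]: "R s \<in> borel_measurable (PiM I \<nu>)" if "s \<in> space ?E" for s
    unfolding R_def[abs_def] using measurable_Pair1[OF rademacher_sup_measurable that] by simp
  define r where "r s = (\<integral>z. R s z \<partial>PiM I \<nu>)" for s
  have rm[measurable]: "r \<in> borel_measurable ?E"
    unfolding r_def[abs_def] R_def
    by (rule S.borel_measurable_lebesgue_integral)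
      (use measurable_pair_swap[OF rademacher_sup_measurable] in \<open>simp add: case_prod_beta'\<close>)
  have rB: "\<bar>r s\<bar> \<le> B" if "s \<in> space ?E" for s
    unfolding r_def using that RB by (intro S.abs_integral_le) auto
  have flip_meas[measurable]: "flip \<in> ?E \<rightarrow>\<^sub>M ?E"
    unfolding flip_def[abs_def] by (rule integral_sign_flip(2)[OF finite_I rm])
  have flip_space: "flip s \<in> space ?E" if "s \<in> space ?E" for s
    using measurable_space[OF flip_meas that] .
  define G :: "(nat \<times> nat \<Rightarrow> 'a \<Rightarrow> real) set" where "G = (\<lambda>f k y. e * (w (fst k) * f (fst k) y)) ` F"
  have "(\<integral>z. deviation e z \<partial>PiM I \<nu>) \<le> r s + r (flip s)" if s: "s \<in> space ?E" for s
    unfolding r_def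
  \<comment> \<open>The class \<open>G\<close> already carries the factor \<open>e\<close>, so the
    pattern is \<open>e * s\<close>: the two factors cancel, and the signed suprema are those of
    \<open>F\<close> under \<open>s\<close> and \<open>flip s\<close>.\<close>
  proof (rule Q.symmetrization[where G = G and s = "\<lambda>k. e * s k"
        and B = B and c = "\<Sum>k\<in>I. w (fst k) * b"])
    show "finite I" by (rule finite_I)
    show "R s \<in> borel_measurable (PiM I \<nu>)" "R (flip s) \<in> borel_measurable (PiM I \<nu>)"
      using s flip_space by auto
    show "integrable (PiM I \<nu>) (deviation e)"
      using deviation_bound[OF e] deviation_measurable[OF e] by (intro S.integrable_bounded) auto
    show "e * s k \<in> {-1, 1}" if "k \<in> I" for k
      using e sign_in_space[OF s that] by auto
    show "\<bar>R s z\<bar> \<le> B" "\<bar>R (flip s) z\<bar> \<le> B" if "z \<in> space (PiM I \<nu>)" for z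
      using RB that s flip_space by auto
    have ee: "e * (e * c) = c" for c using e by auto
    fix g assume "g \<in> G"
    then obtain f where f: "f \<in> F" and g: "g = (\<lambda>k y. e * (w (fst k) * f (fst k) y))" by (auto simp: G_def)
    show "g k \<in> borel_measurable (\<nu> k)" if "k \<in> I" for k
    proof -
      note [measurable] = f_measurable[OF f in_I[OF that]]
      show ?thesis unfolding g \<nu>_eq[OF that] by measurable
    qed
    show "\<bar>g k y\<bar> \<le> (\<Sum>k\<in>I. w (fst k) * b)" if "k \<in> I" "y \<in> space (\<nu> k)" for k y
    proof -
      have "\<bar>e\<bar> = 1" using e by auto
      hence "\<bar>g k y\<bar> \<le> w (fst k) * b"
        using w_pos[OF in_I[OF that(1)]] f_bound[OF f in_I[OF that(1)]] that(2)
        unfolding g \<nu>_eq[OF that(1)] by (simp add: abs_mult)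
      also have "\<dots> \<le> (\<Sum>k\<in>I. w (fst k) * b)"
        using that(1) finite_I w_pos[OF in_I] b_nonneg
        by (intro member_le_sum) (auto intro: mult_nonneg_nonneg less_imp_le)
      finally show ?thesis .
    qed
    fix z assume z: "z \<in> space (PiM I \<nu>)"
    show "(\<Sum>k\<in>I. e * s k * g k (z k)) \<le> R s z"
    proof -
      have "(\<Sum>k\<in>I. e * s k * g k (z k)) = (\<Sum>k\<in>I. s k * (w (fst k) * f (fst k) (z k)))"
        unfolding g by (intro sum.cong refl) (use ee in \<open>simp add: mult_ac\<close>)
      thus ?thesis using rademacher_sup_upper[OF f z s] by (simp add: R_def)
    qed
    show "(\<Sum>k\<in>I. - (e * s k) * g k (z k)) \<le> R (flip s) z"
    proof -
      have "(\<Sum>k\<in>I. - (e * s k) * g k (z k)) = (\<Sum>k\<in>I. flip s k * (w (fst k) * f (fst k) (z k)))"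
        unfolding g flip_def by (intro sum.cong refl) (use ee in \<open>simp add: mult_ac\<close>)
      thus ?thesis using rademacher_sup_upper[OF f z flip_space[OF s]] by (simp add: R_def)
    qed
  next
    fix z c
    assume z: "z \<in> space (PiM I \<nu>)"
      and le: "\<And>g. g \<in> G \<Longrightarrow>
        (\<Sum>k\<in>I. (\<integral>y. g k y \<partial>\<nu> k) - g k (z k)) \<le> c"
    show "deviation e z \<le> c"
    proof (subst deviation_le_iff[OF e z], intro ballI)
      fix f assume f: "f \<in> F"
      have "(\<Sum>k\<in>I. e * (w (fst k) * (m f (fst k) - f (fst k) (z k))))
          = (\<Sum>k\<in>I. (\<integral>y. e * (w (fst k) * f (fst k) y) \<partial>\<nu> k) - e * (w (fst k) * f (fst k) (z k)))"
        by (intro sum.cong refl) (simp add: \<nu>_eq m_def right_diff_distrib)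
      also have "\<dots> \<le> c" by (rule le) (use f in \<open>auto simp: G_def\<close>)
      finally show "(\<Sum>k\<in>I. e * (w (fst k) * (m f (fst k) - f (fst k) (z k)))) \<le> c" .
    qed
  qed
  moreover have int: "integrable ?E r" "integrable ?E (\<lambda>s. r (flip s))"
    using rB flip_space by (auto intro!: E.integrable_bounded[where B = B])
  ultimately have "(\<integral>s. (\<integral>z. deviation e z \<partial>PiM I \<nu>) \<partial>?E) \<le> (\<integral>s. r s + r (flip s) \<partial>?E)"
    by (intro integral_mono) auto
  also have "\<dots> = (\<integral>s. r s \<partial>?E) + (\<integral>s. r s \<partial>?E)"
    using int integral_sign_flip(1)[OF finite_I rm, folded flip_def] by simp
  also have "(\<integral>s. r s \<partial>?E) = rademacher_complexity M T N X \<sigma> F"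
    unfolding rademacher_complexity_eq r_def R_def ..
  finally show ?thesis by (simp add: E.prob_space)
qed

lemma deviation_inequality:
  fixes r x :: real
  assumes e: "e \<in> {-1, 1}" and x: "x > 0"
    and r: "1 / real T * (SUP f\<in>F. \<Sum>t=1..T. variance (\<lambda>\<omega>. f t (X t 1 \<omega>))) \<le> r"
  defines "n \<equiv> Min (N ` {1..T})"
  shows "1 - exp (- x) \<le> prob {\<omega> \<in> space M. deviation e (\<xi> \<omega>) \<le> (INF \<alpha>\<in>{0<..}.
      2 * (1 + \<alpha>) * rademacher_complexity M T N X \<sigma> F
      + 2 * sqrt (x * r / (real n * real T)) + (1 + 4 / \<alpha>) * (b * x / (real n * real T)))}"
    (is "_ \<le> prob {\<omega> \<in> space M. _ \<le> ?bound}")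
proof -
  interpret S: prob_space "PiM I \<nu>" by (intro prob_space_PiM prob_space_\<nu>)
  interpret Q: product_prob_space \<nu> I by (rule product_prob_space_\<nu>)
  note [measurable] = deviation_measurable[OF e] \<xi>_measurable
  \<comment> \<open>Every weight is at most \<open>1 / (n T)\<close>, so \<open>U\<close> bounds the
    range of each summand. The constants are such that \<open>U * x / 2\<close> and
    \<open>x * V\<close> are the expressions in the final bound.\<close>
  define U V where "U = 2 * b / (real n * real T)" and "V = r / (real n * real T)"
  have n_le: "n \<le> N t" if "t \<in> {1..T}" for t
    unfolding n_def using that by (intro Min_le) auto
  have "n \<in> N ` {1..T}" unfolding n_def using T by (intro Min_in) auto
  hence n: "1 \<le> n" using N by auto
  have U: "0 \<le> U" using b_nonneg by (simp add: U_def)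
  have w_le: "w t \<le> 1 / (real n * real T)" if "t \<in> {1..T}" for t
    unfolding w_def using n_le[OF that] n T by (intro divide_left_mono) auto
  define v where "v f t = (\<integral>y. (f t y - m f t)\<^sup>2 \<partial>\<mu> t)" for f t
  have v_bound: "v f t \<le> (2 * b)\<^sup>2" if f: "f \<in> F" and t: "t \<in> {1..T}" for f t
    unfolding v_def
  proof (rule prob_space.integral_between(2)[OF prob_space_\<mu>[OF t], where l = 0])
    have [measurable]: "f t \<in> borel_measurable (\<mu> t)" using F_meas f t by simp
    show "(\<lambda>y. (f t y - m f t)\<^sup>2) \<in> borel_measurable (\<mu> t)" by measurable
    show "(f t y - m f t)\<^sup>2 \<le> (2 * b)\<^sup>2" if "y \<in> space (\<mu> t)" for y
      using f_bound[OF f t that] m_bound[OF f t] b_nonneg by (subst abs_le_square_iff[symmetric]) auto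
  qed auto
  \<comment> \<open>The variance hypothesis speaks of a \<open>SUP\<close>; passing from it to a
    single \<open>f\<close> relies on the sums being bounded above, which \<open>v_bound\<close>
    provides.\<close>
  have v_sum: "1 / real T * (\<Sum>t=1..T. v f t) \<le> r" if f: "f \<in> F" for f
  proof -
    have "(\<Sum>t=1..T. v f t) \<le> (SUP f\<in>F. \<Sum>t=1..T. v f t)"
    proof (rule cSUP_upper[OF f])
      show "bdd_above ((\<lambda>f. \<Sum>t=1..T. v f t) ` F)"
        using v_bound by (intro bdd_aboveI[of _ "\<Sum>t=1..T. (2 * b)\<^sup>2"]) (auto intro!: sum_mono simp del: sum_constant)
    qed
    also have "\<dots> = (SUP f\<in>F. \<Sum>t=1..T. variance (\<lambda>\<omega>. f t (X t 1 \<omega>)))"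
      unfolding v_def by (intro arg_cong[where f = Sup] image_cong sum.cong refl) (simp only: variance_eq)
    finally have "1 / real T * (\<Sum>t=1..T. v f t) \<le> 1 / real T * \<dots>" by (intro mult_left_mono) auto
    thus ?thesis using r by simp
  qed
  have v_nonneg: "0 \<le> v f t" for f t unfolding v_def by simp
  obtain f0 where f0: "f0 \<in> F" using F by auto
  have "0 \<le> r" using v_sum[OF f0] v_nonneg by (meson divide_nonneg_nonneg mult_nonneg_nonneg of_nat_0_le_iff order_trans sum_nonneg zero_le_one)
  hence V: "0 \<le> V" by (simp add: V_def)
  define E where "E = (\<integral>z. deviation e z \<partial>PiM I \<nu>)"
  \<comment> \<open>This threshold does not contain \<alpha> and lies below every member of the
    infimum, so one event serves all \<alpha> together.\<close>
  define a where "a = E + 2 * sqrt (x * (V + 2 * U * E)) + U * x / 2"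
  define G :: "(nat \<times> nat \<Rightarrow> 'a \<Rightarrow> real) set" where "G = (\<lambda>f k y. e * (w (fst k) * (m f (fst k) - f (fst k) y))) ` F"
  have G: "\<And>k. k \<in> I \<Longrightarrow> g k \<in> borel_measurable (\<nu> k)" "\<And>k. k \<in> I \<Longrightarrow> (\<integral>y. g k y \<partial>\<nu> k) = 0"
    "\<And>k y y'. k \<in> I \<Longrightarrow> y \<in> space (\<nu> k) \<Longrightarrow> y' \<in> space (\<nu> k) \<Longrightarrow> g k y - g k y' \<le> U"
    "(\<Sum>k\<in>I. \<integral>y. (g k y)\<^sup>2 \<partial>\<nu> k) \<le> V" if "g \<in> G" for g
  proof -
    from that obtain f where f: "f \<in> F" and g: "g = (\<lambda>k y. e * (w (fst k) * (m f (fst k) - f (fst k) y)))" by (auto simp: G_def)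
    have f_int: "integrable (\<mu> t) (f t)" if "t \<in> {1..T}" for t
      using F_meas f f_bound that
      by (intro prob_space.integrable_bounded[OF prob_space_\<mu>, where B = b]) auto
    {
      fix k assume k: "k \<in> I"
      interpret \<mu>k: prob_space "\<mu> (fst k)" by (rule prob_space_\<mu>[OF in_I[OF k]])
      show "g k \<in> borel_measurable (\<nu> k)"
      proof -
        note [measurable] = f_measurable[OF f in_I[OF k]]
        show ?thesis unfolding g \<nu>_eq[OF k] by measurable
      qed
      show "(\<integral>y. g k y \<partial>\<nu> k) = 0"
        using f_int[OF in_I[OF k]] unfolding g \<nu>_eq[OF k] by (simp add: m_def \<mu>k.prob_space)
      fix y y' assume y: "y \<in> space (\<nu> k)" "y' \<in> space (\<nu> k)"
      have "g k y - g k y' = w (fst k) * (e * (f (fst k) y' - f (fst k) y))"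
        unfolding g by (simp add: algebra_simps)
      also have "\<dots> \<le> w (fst k) * (2 * b)"
        using e w_pos[OF in_I[OF k]] f_bound[OF f in_I[OF k], of y] f_bound[OF f in_I[OF k], of y'] y
        unfolding \<nu>_eq[OF k] by (intro mult_left_mono) auto
      also have "\<dots> \<le> 1 / (real n * real T) * (2 * b)"
        using w_le[OF in_I[OF k]] b_nonneg by (intro mult_right_mono) auto
      finally show "g k y - g k y' \<le> U" by (simp add: U_def)
    }
    have "(\<integral>y. (g k y)\<^sup>2 \<partial>\<nu> k) = w (fst k) * (w (fst k) * v f (fst k))" if k: "k \<in> I" for k
    proof -
      have "(g k y)\<^sup>2 = (w (fst k))\<^sup>2 * (f (fst k) y - m f (fst k))\<^sup>2" for y
        unfolding g using e by (auto simp: power_mult_distrib power2_commute)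
      thus ?thesis unfolding \<nu>_eq[OF k] v_def by (simp add: power2_eq_square)
    qed
    hence "(\<Sum>k\<in>I. \<integral>y. (g k y)\<^sup>2 \<partial>\<nu> k) = (\<Sum>k\<in>I. w (fst k) * (w (fst k) * v f (fst k)))"
      by (intro sum.cong) auto
    \<comment> \<open>Summing a squared weight over the \<open>N t\<close> copies of task
      \<open>t\<close> leaves \<open>w t / T\<close>. The remaining weight is at most
      \<open>1 / (n T)\<close>, and the factor \<open>1 / T\<close> forms the average that
      \<open>r\<close> bounds.\<close>
    also have "\<dots> = 1 / real T * (\<Sum>t=1..T. w t * v f t)"
      by (rule weighted_sum_I_fst)
    also have "\<dots> \<le> 1 / real T * (\<Sum>t=1..T. 1 / (real n * real T) * v f t)"
      using w_le v_nonneg by (intro mult_left_mono sum_mono mult_right_mono) auto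
    also have "\<dots> = 1 / (real n * real T) * (1 / real T * (\<Sum>t=1..T. v f t))"
      by (simp add: sum_distrib_left mult_ac)
    also have "\<dots> \<le> 1 / (real n * real T) * r"
      using v_sum[OF f] by (intro mult_left_mono) auto
    finally show "(\<Sum>k\<in>I. \<integral>y. (g k y)\<^sup>2 \<partial>\<nu> k) \<le> V" by (simp add: V_def)
  qed
  have lub: "deviation e z \<le> c \<longleftrightarrow> (\<forall>g\<in>G. (\<Sum>k\<in>I. g k (z k)) \<le> c)" if "z \<in> space (PiM I \<nu>)" for z c
    using deviation_le_iff[OF e that] by (simp add: G_def)
  have "G \<noteq> {}" using F by (simp add: G_def)
  note conc_rule = Q.sup_concentration[where Z = "deviation e", OF finite_I I_nonempty this _ _ _ U _ _ _ x]
  have conc: "measure (PiM I \<nu>) {z \<in> space (PiM I \<nu>). a < deviation e z} \<le> exp (- x)"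
    unfolding a_def E_def by (rule conc_rule(1)) (fact G lub deviation_measurable[OF e])+
  have E: "0 \<le> E"
    unfolding E_def by (rule conc_rule(2)) (fact G lub deviation_measurable[OF e])+
  have "a \<le> ?bound"
  proof (rule cINF_greatest)
    fix \<alpha> :: real assume "\<alpha> \<in> {0<..}"
    hence "a \<le> 2 * (1 + \<alpha>) * rademacher_complexity M T N X \<sigma> F + 2 * sqrt (x * V) + (1 + 4 / \<alpha>) * (U * x / 2)"
      unfolding a_def using E V U x expectation_deviation_le[OF e, folded E_def]
      by (intro sqrt_deviation_le) auto
    thus "a \<le> 2 * (1 + \<alpha>) * rademacher_complexity M T N X \<sigma> F
      + 2 * sqrt (x * r / (real n * real T)) + (1 + 4 / \<alpha>) * (b * x / (real n * real T))"
      by (simp add: U_def V_def)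
  qed auto
  hence "{z \<in> space (PiM I \<nu>). ?bound < deviation e z} \<subseteq> {z \<in> space (PiM I \<nu>). a < deviation e z}"
    by (auto intro: le_less_trans)
  hence "measure (PiM I \<nu>) {z \<in> space (PiM I \<nu>). ?bound < deviation e z}
      \<le> measure (PiM I \<nu>) {z \<in> space (PiM I \<nu>). a < deviation e z}"
    by (rule S.finite_measure_mono) measurable
  hence "measure (PiM I \<nu>) {z \<in> space (PiM I \<nu>). ?bound < deviation e z} \<le> exp (- x)"
    using conc by linarith
  moreover have "measure (PiM I \<nu>) {z \<in> space (PiM I \<nu>). deviation e z \<le> ?bound}
      = 1 - measure (PiM I \<nu>) {z \<in> space (PiM I \<nu>). ?bound < deviation e z}"
    by (subst S.prob_neg[symmetric]) (auto simp: not_less)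
  moreover have "measure (PiM I \<nu>) {z \<in> space (PiM I \<nu>). deviation e z \<le> ?bound}
      = prob {\<omega> \<in> space M. deviation e (\<xi> \<omega>) \<le> ?bound}"
  proof -
    have "measure (distr M (PiM I \<nu>) \<xi>) {z \<in> space (PiM I \<nu>). deviation e z \<le> ?bound}
      = prob {\<omega> \<in> space M. deviation e (\<xi> \<omega>) \<le> ?bound}"
      using measurable_space[OF \<xi>_measurable]
      by (subst measure_distr) (auto intro!: arg_cong[where f = prob])
    thus ?thesis unfolding \<xi>_distr .
  qed
  ultimately show ?thesis by linarith
qed

end

theorem theorem3p2:
  fixes M :: "'w measure" and \<mu> :: "nat \<Rightarrow> 'a measure"
    and T :: nat and N :: "nat \<Rightarrow> nat"
    and X :: "nat \<Rightarrow> nat \<Rightarrow> 'w \<Rightarrow> 'a" and \<sigma> :: "nat \<Rightarrow> nat \<Rightarrow> 'w \<Rightarrow> real"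
    and F :: "(nat \<Rightarrow> 'a \<Rightarrow> real) set" and b r x :: real
  defines "n \<equiv> Min (N ` {1..T})"
  defines "bound \<equiv> INF \<alpha>\<in>{0<..}.
      2 * (1 + \<alpha>) * rademacher_complexity M T N X \<sigma> F
      + 2 * sqrt (x * r / (real n * real T))
      + (1 + 4 / \<alpha>) * (b * x / (real n * real T))"
  assumes "prob_space M"
    and "T \<ge> 1" and "\<forall>t\<in>{1..T}. N t \<ge> 1"
    and "multitask_sample M T N \<mu> X"
    and "rademacher_signs M T N \<sigma>"
    and "signs_indep_of_sample M T N \<mu> X \<sigma>"
    and "F \<noteq> {}"
    and "\<forall>f\<in>F. \<forall>t\<in>{1..T}. f t \<in> borel_measurable (\<mu> t)"
    and "\<forall>f\<in>F. \<forall>t\<in>{1..T}. \<forall>y\<in>space (\<mu> t). \<bar>f t y\<bar> \<le> b"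
    and "measurable_suprema M T N \<mu> X F"
    and "1 / real T * (SUP f\<in>F. \<Sum>t=1..T. prob_space.variance M (\<lambda>\<omega>. f t (X t 1 \<omega>))) \<le> r"
    and "x > 0"
  shows "measure M {\<omega> \<in> space M.
           (SUP f\<in>F. true_mean M T X f - empirical_mean T N f (\<lambda>t i. X t i \<omega>)) \<le> bound}
         \<ge> 1 - exp (- x)
       \<and> measure M {\<omega> \<in> space M.
           (SUP f\<in>F. empirical_mean T N f (\<lambda>t i. X t i \<omega>) - true_mean M T X f) \<le> bound}
         \<ge> 1 - exp (- x)"
proof -
  interpret prob_space M by fact
  interpret multitask M \<mu> T N X \<sigma> F b
    by (intro multitask.intro multitask_axioms.intro) fact+
  have "1 - exp (- x) \<le> prob {\<omega> \<in> space M. deviation e (\<xi> \<omega>) \<le> bound}" if "e \<in> {-1, 1}" for e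
    unfolding bound_def n_def using that assms by (intro deviation_inequality) auto
  from this[of 1] this[of "-1"] show ?thesis
    by (simp add: deviation_def empirical_mean_X)
qed

end
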